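(* Let $\Delta$ be a flag homology $2$-sphere and $v$ a vertex of $\Delta$. Then either (i) some vertex of $\Delta$ is non-adjacent to at most two vertices of $\Delta$, or (ii) there exists an equator $E$ of $\Delta$ which is not the link of any vertex of $\Delta$ and does not contain $v$.
   Context: Flag: faces are exactly the cliques of the $1$-skeleton. Homology sphere over a field $\mathbb{F}$: for every face $\sigma$ (including $\emptyset$), $\widetilde H_i(\mathrm{lk}_\sigma\Delta;\mathbb{F})$ vanishes for $i<\dim\Delta-|\sigma|$ and is $\mathbb{F}$ for $i=\dim\Delta-|\sigma|$, where $\mathrm{lk}_\sigma\Delta=\{\tau\in\Delta:\tau\cap\sigma=\emptyset,\tau\cup\sigma\in\Delta\}$. An equator of $\Delta$ is an induced subcomplex $\Delta[W]=\{\sigma\in\Delta:\sigma\subseteq W\}$ that is a flag homology sphere of dimension $\dim\Delta-1$ (here, an induced cycle which is a homology $1$-sphere). *)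

theory Defs imports Main begin

text \<open>Finite abstract simplicial complexes, represented by the set of their faces,
  the empty face included.\<close>

definition simplicial_complex :: "'a set set \<Rightarrow> bool" where
  "simplicial_complex \<Delta> \<longleftrightarrow>
     finite \<Delta> \<and> (\<forall>\<sigma>\<in>\<Delta>. finite \<sigma>) \<and> {} \<in> \<Delta> \<and> (\<forall>\<sigma>\<in>\<Delta>. \<forall>\<tau>. \<tau> \<subseteq> \<sigma> \<longrightarrow> \<tau> \<in> \<Delta>)"

definition vertices :: "'a set set \<Rightarrow> 'a set" where
  "vertices \<Delta> = \<Union>\<Delta>"

definition dim_complex :: "'a set set \<Rightarrow> int" where
  "dim_complex \<Delta> = int (Max (card ` \<Delta>)) - 1"

definition link :: "'a set set \<Rightarrow> 'a set \<Rightarrow> 'a set set" where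
  "link \<Delta> \<sigma> = {\<tau>\<in>\<Delta>. \<tau> \<inter> \<sigma> = {} \<and> \<tau> \<union> \<sigma> \<in> \<Delta>}"

definition induced :: "'a set set \<Rightarrow> 'a set \<Rightarrow> 'a set set" where
  "induced \<Delta> W = {\<sigma>\<in>\<Delta>. \<sigma> \<subseteq> W}"

definition adjacent :: "'a set set \<Rightarrow> 'a \<Rightarrow> 'a \<Rightarrow> bool" where
  "adjacent \<Delta> u w \<longleftrightarrow> u \<noteq> w \<and> {u, w} \<in> \<Delta>"

definition cliques :: "'a set set \<Rightarrow> 'a set set" where
  "cliques \<Delta> = {K. K \<subseteq> vertices \<Delta> \<and> (\<forall>x\<in>K. \<forall>y\<in>K. x \<noteq> y \<longrightarrow> adjacent \<Delta> x y)}"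

definition flag :: "'a set set \<Rightarrow> bool" where
  "flag \<Delta> \<longleftrightarrow> simplicial_complex \<Delta> \<and> \<Delta> = cliques \<Delta>"

text \<open>Reduced simplicial homology with coefficients in a field, by oriented chains. An
  \<open>i\<close>-chain is an alternating function on the orderings of the \<open>i\<close>-faces; the oriented
  simplex \<open>[v\<^sub>0, \<dots>, v\<^sub>i]\<close> is the chain whose value at an ordering of
  \<open>{v\<^sub>0, \<dots>, v\<^sub>i}\<close> is the sign of that ordering relative to \<open>(v\<^sub>0, \<dots>, v\<^sub>i)\<close>.
  The degree \<open>i\<close> is an integer; degree \<open>-1\<close> belongs to the empty face, so that the
  boundary map out of degree \<open>0\<close> is the augmentation, and there are only zero chains
  below degree \<open>-1\<close>.\<close>

definition chains :: "'a set set \<Rightarrow> int \<Rightarrow> ('a list \<Rightarrow> 'f::field) set" where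
  "chains \<Delta> i = {c.
     (\<forall>xs. c xs \<noteq> 0 \<longrightarrow> distinct xs \<and> set xs \<in> \<Delta> \<and> int (length xs) = i + 1) \<and>
     (\<forall>xs x y ys. c (xs @ x # y # ys) = - c (xs @ y # x # ys))}"

text \<open>On the oriented simplex \<open>[v\<^sub>0, \<dots>, v\<^sub>i]\<close> this is the usual alternating sum of the
  oriented simplices omitting \<open>v\<^sub>j\<close>: moving \<open>v\<^sub>j\<close> to the front has sign \<open>(-1)\<^sup>j\<close>.\<close>

definition boundary_map :: "'a set set \<Rightarrow> ('a list \<Rightarrow> 'f::field) \<Rightarrow> ('a list \<Rightarrow> 'f)" where
  "boundary_map \<Delta> c = (\<lambda>xs. \<Sum>v\<in>vertices \<Delta>. c (v # xs))"

definition cycles :: "'a set set \<Rightarrow> int \<Rightarrow> ('a list \<Rightarrow> 'f::field) set" where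
  "cycles \<Delta> i = {c \<in> chains \<Delta> i. boundary_map \<Delta> c = (\<lambda>_. 0)}"

definition boundaries :: "'a set set \<Rightarrow> int \<Rightarrow> ('a list \<Rightarrow> 'f::field) set" where
  "boundaries \<Delta> i = boundary_map \<Delta> ` chains \<Delta> (i + 1)"

definition homologous ::
    "'a set set \<Rightarrow> int \<Rightarrow> (('a list \<Rightarrow> 'f::field) \<times> ('a list \<Rightarrow> 'f)) set" where
  "homologous \<Delta> i =
     {(c, d). c \<in> cycles \<Delta> i \<and> d \<in> cycles \<Delta> i \<and> (\<lambda>xs. c xs - d xs) \<in> boundaries \<Delta> i}"

definition homology_class ::
    "'a set set \<Rightarrow> int \<Rightarrow> ('a list \<Rightarrow> 'f::field) \<Rightarrow> ('a list \<Rightarrow> 'f) set" where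
  "homology_class \<Delta> i c = homologous \<Delta> i `` {c}"

definition reduced_homology :: "'a set set \<Rightarrow> int \<Rightarrow> ('a list \<Rightarrow> 'f::field) set set" where
  "reduced_homology \<Delta> i = cycles \<Delta> i // homologous \<Delta> i"

text \<open>The argument of type \<open>'f itself\<close> is the coefficient field.\<close>

definition homology_vanishes :: "'f::field itself \<Rightarrow> 'a set set \<Rightarrow> int \<Rightarrow> bool" where
  "homology_vanishes F \<Delta> i \<longleftrightarrow>
     reduced_homology \<Delta> i = {homology_class \<Delta> i (\<lambda>_. 0 :: 'f)}"

text \<open>Isomorphic to the field as a vector space over it; the operations on homology are
  induced from those on cycles.\<close>

definition homology_is_field :: "'f::field itself \<Rightarrow> 'a set set \<Rightarrow> int \<Rightarrow> bool" where
  "homology_is_field F \<Delta> i \<longleftrightarrow>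
     (\<exists>\<phi> :: ('a list \<Rightarrow> 'f) set \<Rightarrow> 'f.
        bij_betw \<phi> (reduced_homology \<Delta> i) UNIV \<and>
        (\<forall>c\<in>cycles \<Delta> i. \<forall>d\<in>cycles \<Delta> i.
           \<phi> (homology_class \<Delta> i (\<lambda>xs. c xs + d xs))
             = \<phi> (homology_class \<Delta> i c) + \<phi> (homology_class \<Delta> i d)) \<and>
        (\<forall>a. \<forall>c\<in>cycles \<Delta> i.
           \<phi> (homology_class \<Delta> i (\<lambda>xs. a * c xs)) = a * \<phi> (homology_class \<Delta> i c)))"

definition homology_sphere :: "'f::field itself \<Rightarrow> 'a set set \<Rightarrow> bool" where
  "homology_sphere F \<Delta> \<longleftrightarrow> simplicial_complex \<Delta> \<and>
     (\<forall>\<sigma>\<in>\<Delta>.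
        (\<forall>i < dim_complex \<Delta> - int (card \<sigma>). homology_vanishes F (link \<Delta> \<sigma>) i) \<and>
        homology_is_field F (link \<Delta> \<sigma>) (dim_complex \<Delta> - int (card \<sigma>)))"

definition equator :: "'f::field itself \<Rightarrow> 'a set set \<Rightarrow> 'a set set \<Rightarrow> bool" where
  "equator F \<Delta> E \<longleftrightarrow>
     (\<exists>W. W \<subseteq> vertices \<Delta> \<and> E = induced \<Delta> W) \<and>
     flag E \<and> homology_sphere F E \<and> dim_complex E = dim_complex \<Delta> - 1"

end

theory Submission imports Defs begin

text \<open>
  Everything is read off the graph of \<open>\<Delta>\<close>, using a fundamental 2-cycle \<open>Z\<close>, the vanishing of
  \<open>H\<^sub>1\<close>, the connectedness of vertex links, and the fact that every edge has exactly two common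
  neighbours, which are not adjacent. The substitute for planarity is a form of Alexander duality:
  if the vertices other than \<open>c\<close> split into two connected sets, then each of them meets the link
  of \<open>c\<close> in a connected set.

  If there are edges \<open>vx\<close> and \<open>uw\<close> with no vertex in common and no edge between them, a minimal
  vertex set \<open>C\<close> separating them is an induced cycle, and since both of its sides have more than one
  vertex it is not a link. Otherwise every neighbour of \<open>v\<close> is adjacent to an end of every edge
  lying in the set \<open>R\<close> of non-neighbours of \<open>v\<close>. If \<open>R\<close> has at least three elements, it contains
  (being connected) a vertex \<open>w\<close> with two neighbours in \<open>R\<close>; then \<open>w\<close> is adjacent to all of
  \<open>R - {w}\<close> and to all neighbours of \<open>v\<close> but at most one.
\<close>

section \<open>Graphs and chains of low degree\<close>

text \<open>Neither a planar embedding nor a Jordan curve theorem is at hand. Connectedness of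
  traces and of \<open>C\<close> is therefore proved by pairing: a loop is built that crosses a
  supposed cut exactly once, and since the loop bounds a 2-chain, the crossings, counted in the
  field, also sum to 0. The coefficients of \<open>Z\<close> are not normalised to signs; besides
  being a cycle, all that matters about \<open>Z\<close> is that it vanishes on no triangle, so that
  a multiple of it can cancel any 2-chain on a chosen triangle.

  Far edges rather than far vertices are taken because each side of \<open>C\<close> has to keep two
  vertices; \<open>v\<close> is put into the side \<open>A\<close>, which keeps it off the equator.
  When \<open>R\<close> has at most two elements, \<open>v\<close> itself satisfies the first
  alternative.\<close>

text \<open>Connectedness phrased by cuts, so that no walks are needed: the witness for a disconnection
  is directly the set over which chains are summed.\<close>

definition cut_connected :: "('a \<Rightarrow> 'a \<Rightarrow> bool) \<Rightarrow> 'a set \<Rightarrow> bool" where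
  "cut_connected r S \<longleftrightarrow> (\<forall>T\<subseteq>S. T \<noteq> {} \<longrightarrow> T \<noteq> S \<longrightarrow> (\<exists>a\<in>T. \<exists>b\<in>S - T. r a b))"

lemma cut_connectedD:
  assumes "cut_connected r S" "T \<subseteq> S" "T \<noteq> {}" "T \<noteq> S"
  obtains a b where "a \<in> T" "b \<in> S" "b \<notin> T" "r a b"
  using assms unfolding cut_connected_def by blast

text \<open>The induction principle that replaces walks: if \<open>P\<close> failed at
  \<open>b\<close>, the elements with \<open>P\<close> and those without it would form a cut that no
  edge crosses.\<close>

lemma cut_connected_propagate:
  assumes "cut_connected r S" "a \<in> S" "P a" "b \<in> S"
    and step: "\<And>x y. x \<in> S \<Longrightarrow> y \<in> S \<Longrightarrow> P x \<Longrightarrow> r x y \<Longrightarrow> P y"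
  shows "P b"
proof (rule ccontr)
  assume "\<not> P b"
  then obtain x y where "x \<in> {x \<in> S. P x}" "y \<in> S" "y \<notin> {x \<in> S. P x}" "r x y"
    using cut_connectedD[OF assms(1), of "{x \<in> S. P x}"] assms(2-4) by blast
  then show False using step by blast
qed

text \<open>A supposed cut \<open>T\<close> contains or avoids each member of the family entirely,
  according to whether it contains the common element \<open>w\<close>.\<close>

lemma cut_connected_Union:
  assumes "\<And>T. T \<in> F \<Longrightarrow> cut_connected r T \<and> w \<in> T" and "\<And>x y. r x y \<Longrightarrow> r y x"
  shows "cut_connected r (\<Union>F)"
  unfolding cut_connected_def
proof (intro allI impI, rule ccontr)
  fix T assume T: "T \<subseteq> \<Union>F" "T \<noteq> {}" "T \<noteq> \<Union>F"
    and no: "\<not> (\<exists>a\<in>T. \<exists>b\<in>\<Union>F - T. r a b)"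
  have "w \<in> T \<longleftrightarrow> x \<in> T" if "X \<in> F" "x \<in> X" for X x
    by (rule cut_connected_propagate[of r X w "\<lambda>x. w \<in> T \<longleftrightarrow> x \<in> T" x])
       (use assms that no in blast)+
  then show False using T by blast
qed

lemma cut_connected_Un:
  assumes "cut_connected r S" "cut_connected r T" "w \<in> S" "w \<in> T" "\<And>x y. r x y \<Longrightarrow> r y x"
  shows "cut_connected r (S \<union> T)"
  using cut_connected_Union[of "{S, T}" r w] assms by auto

lemma cut_connected_singleton: "cut_connected r {a}"
  unfolding cut_connected_def by blast

lemma cut_connected_pair:
  assumes "r a b" "r b a"
  shows "cut_connected r {a, b}"
  unfolding cut_connected_def
proof (intro allI impI)
  fix T assume "T \<subseteq> {a, b}" "T \<noteq> {}" "T \<noteq> {a, b}"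
  then have "(a \<in> T \<and> b \<notin> T) \<or> (b \<in> T \<and> a \<notin> T)" by blast
  then show "\<exists>x\<in>T. \<exists>y\<in>{a, b} - T. r x y" using assms by blast
qed

lemma cut_connected_insert:
  assumes "cut_connected r S" "a \<in> S" "r a b" "\<And>x y. r x y \<Longrightarrow> r y x"
  shows "cut_connected r (insert b S)"
proof -
  have "cut_connected r (S \<union> {a, b})"
    by (rule cut_connected_Un[OF assms(1) cut_connected_pair, of a b a]) (use assms in auto)
  moreover have "S \<union> {a, b} = insert b S" using assms(2) by auto
  ultimately show ?thesis by simp
qed

lemma cut_connected_attach:
  assumes "cut_connected r S" "\<And>x. x \<in> T \<Longrightarrow> \<exists>a\<in>S. r a x" "S \<noteq> {}"
    and sym: "\<And>x y. r x y \<Longrightarrow> r y x"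
  shows "cut_connected r (S \<union> T)"
proof -
  obtain s where s: "s \<in> S" using assms(3) by blast
  have "cut_connected r (\<Union>(insert S ((\<lambda>x. insert x S) ` T)))"
    by (rule cut_connected_Union[where w = s])
       (use s assms(1,2) sym cut_connected_insert[of r S] in blast)+
  moreover have "\<Union>(insert S ((\<lambda>x. insert x S) ` T)) = S \<union> T" by auto
  ultimately show ?thesis by simp
qed

definition component :: "('a \<Rightarrow> 'a \<Rightarrow> bool) \<Rightarrow> 'a set \<Rightarrow> 'a \<Rightarrow> 'a set" where
  "component r S w = \<Union>{T. T \<subseteq> S \<and> w \<in> T \<and> cut_connected r T}"

lemma component_subset: "component r S w \<subseteq> S"
  unfolding component_def by blast

lemma component_greatest: "T \<subseteq> S \<Longrightarrow> w \<in> T \<Longrightarrow> cut_connected r T \<Longrightarrow> T \<subseteq> component r S w"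
  unfolding component_def by blast

lemma component_self: "w \<in> S \<Longrightarrow> w \<in> component r S w"
  using component_greatest[of "{w}" S w r] cut_connected_singleton[of r w] by auto

lemma component_connected:
  assumes "\<And>x y. r x y \<Longrightarrow> r y x"
  shows "cut_connected r (component r S w)"
  unfolding component_def by (rule cut_connected_Union[where w = w]) (use assms in auto)

lemma component_closed:
  assumes "\<And>x y. r x y \<Longrightarrow> r y x" "w \<in> S" "x \<in> component r S w" "y \<in> S" "r x y"
  shows "y \<in> component r S w"
proof -
  have "cut_connected r (insert y (component r S w))"
    by (rule cut_connected_insert[OF component_connected assms(3,5)]) (use assms(1) in blast)+
  then show ?thesis
    using component_greatest[of "insert y (component r S w)" S w r] component_subset[of r S w]
      component_self[of w S r] assms by auto
qed

text \<open>The diagonal has a hypothesis of its own because antisymmetry says nothing about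
  \<open>f x x\<close> in characteristic 2.\<close>

lemma sum_antisymmetric_zero:
  fixes f :: "'a \<Rightarrow> 'a \<Rightarrow> 'f::field"
  assumes "finite S" "\<And>x y. f x y = - f y x" "\<And>x. f x x = 0"
  shows "(\<Sum>x\<in>S. \<Sum>y\<in>S. f x y) = 0"
  using assms(1)
proof (induction S rule: finite_induct)
  case (insert a S)
  have "(\<Sum>x\<in>S. f x a) = - (\<Sum>y\<in>S. f a y)"
    by (subst sum_negf[symmetric]) (use assms(2) in \<open>blast intro: sum.cong\<close>)
  then show ?case using insert by (simp add: sum.distrib assms(3))
qed simp

section \<open>Alternating 1- and 2-chains on a graph\<close>

definition chain1 :: "('a \<Rightarrow> 'a \<Rightarrow> bool) \<Rightarrow> ('a \<Rightarrow> 'a \<Rightarrow> 'f::field) \<Rightarrow> bool" where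
  "chain1 r k \<longleftrightarrow> (\<forall>x y. k x y = - k y x \<and> (k x y \<noteq> 0 \<longrightarrow> r x y))"

definition chain2 :: "('a \<Rightarrow> 'a \<Rightarrow> bool) \<Rightarrow> ('a \<Rightarrow> 'a \<Rightarrow> 'a \<Rightarrow> 'f::field) \<Rightarrow> bool" where
  "chain2 r e \<longleftrightarrow> (\<forall>x y z. e x y z = - e y x z \<and> e x y z = - e x z y \<and>
     (e x y z \<noteq> 0 \<longrightarrow> r x y \<and> r y z \<and> r x z))"

lemma chain2_swap:
  assumes "chain2 r e"
  shows "e x y z = - e y x z" "e x y z = - e x z y" "e x y z = - e z y x"
    "e x y z = e y z x" "e x y z = e z x y"
proof -
  have *: "e a b c = - e b a c" "e a b c = - e a c b" for a b c
    using assms unfolding chain2_def by blast+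
  show "e x y z = - e y x z" "e x y z = - e x z y" by (rule *)+
  show "e x y z = e y z x" "e x y z = e z x y" "e x y z = - e z y x"
    using *(1)[of x y z] *(2)[of y x z] *(2)[of x y z] *(1)[of x z y] *(2)[of z x y] by simp_all
qed

lemma chain2_support: "chain2 r e \<Longrightarrow> e x y z \<noteq> 0 \<Longrightarrow> r x y \<and> r y z \<and> r x z"
  unfolding chain2_def by blast

text \<open>The oriented edge \<open>[p, q]\<close>. Boundaries sum over the first argument, so that
  its boundary is \<open>q\<close> minus \<open>p\<close>.\<close>

definition edge_chain :: "'a \<Rightarrow> 'a \<Rightarrow> 'a \<Rightarrow> 'a \<Rightarrow> 'f::field" where
  "edge_chain p q x y = of_bool (x = p \<and> y = q) - of_bool (x = q \<and> y = p)"

lemma chain1_edge_chain: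
  assumes "r p q" "r q p"
  shows "chain1 r (edge_chain p q :: 'a \<Rightarrow> 'a \<Rightarrow> 'f::field)"
  unfolding chain1_def
proof (intro allI conjI impI)
  fix x y
  show "edge_chain p q x y = - (edge_chain p q y x :: 'f::field)"
    unfolding edge_chain_def by (simp add: conj_commute)
  assume "edge_chain p q x y \<noteq> (0 :: 'f)"
  then have "x = p \<and> y = q \<or> x = q \<and> y = p" unfolding edge_chain_def by (auto split: if_splits)
  then show "r x y" using assms by blast
qed

lemma sum_edge_chain:
  assumes "finite V" "p \<in> V" "q \<in> V"
  shows "(\<Sum>t\<in>V. edge_chain p q t y) = (of_bool (y = q) - of_bool (y = p) :: 'f::field)"
proof -
  have "(\<Sum>t\<in>V. of_bool (t = a \<and> y = b)) = (of_bool (y = b) :: 'f)" if "a \<in> V" for a b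
    using that assms(1) by (cases "y = b") (auto simp: of_bool_def if_distrib cong: if_cong)
  then show ?thesis using assms unfolding edge_chain_def by (simp add: sum_subtractf)
qed

lemma chain1_add: "chain1 r k \<Longrightarrow> chain1 r l \<Longrightarrow> chain1 r (\<lambda>x y. k x y + l x y ::  'f::field)"
  unfolding chain1_def
proof (intro allI conjI impI)
  fix x y
  assume k: "\<forall>x y. k x y = - k y x \<and> (k x y \<noteq> 0 \<longrightarrow> r x y)"
    and l: "\<forall>x y. l x y = - l y x \<and> (l x y \<noteq> 0 \<longrightarrow> r x y)"
  have "k x y = - k y x" "l x y = - l y x" using k l by blast+
  then show "k x y + l x y = - (k y x + l y x)" by simp
  assume "k x y + l x y \<noteq> 0"
  then have "k x y \<noteq> 0 \<or> l x y \<noteq> 0" by auto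
  then show "r x y" using k l by blast
qed

text \<open>Built by propagation: crossing an edge from \<open>x\<close> to \<open>y\<close> adds
  \<open>edge_chain x y\<close> and moves the positive end of the boundary from \<open>x\<close> to
  \<open>y\<close>.\<close>

lemma path_chain:
  assumes "finite V" and adj: "\<And>x y. adj x y \<Longrightarrow> x \<in> V \<and> adj y x"
    and D: "cut_connected adj D" "a \<in> D" "b \<in> D"
  obtains k :: "'a \<Rightarrow> 'a \<Rightarrow> 'f::field" where "chain1 adj k" "\<And>x y. k x y \<noteq> 0 \<Longrightarrow> x \<in> D \<and> y \<in> D"
    "\<And>y. (\<Sum>t\<in>V. k t y) = of_bool (y = b) - of_bool (y = a)"
proof -
  let ?P = "\<lambda>b. \<exists>k :: 'a \<Rightarrow> 'a \<Rightarrow> 'f. chain1 adj k \<and> (\<forall>x y. k x y \<noteq> 0 \<longrightarrow> x \<in> D \<and> y \<in> D) \<and>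
    (\<forall>y. (\<Sum>t\<in>V. k t y) = of_bool (y = b) - of_bool (y = a))"
  have "?P b"
  proof (rule cut_connected_propagate[OF D(1,2), of ?P b])
    show "?P a" by (rule exI[of _ "\<lambda>_ _. 0"]) (simp add: chain1_def)
    fix x y assume xy: "x \<in> D" "y \<in> D" "?P x" "adj x y"
    then obtain k where k: "chain1 adj k" "\<forall>x y. k x y \<noteq> 0 \<longrightarrow> x \<in> D \<and> y \<in> D"
      "\<forall>y. (\<Sum>t\<in>V. k t y) = (of_bool (y = x) - of_bool (y = a) :: 'f)" by blast
    have "x \<in> V" "y \<in> V" using xy(4) adj by blast+
    then have "\<forall>s. (\<Sum>t\<in>V. k t s + edge_chain x y t s) = of_bool (s = y) - of_bool (s = a)"
      using k(3) by (simp add: sum.distrib sum_edge_chain[OF assms(1)])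
    moreover have "\<And>s t. k s t + edge_chain x y s t \<noteq> 0 \<Longrightarrow> s \<in> D \<and> t \<in> D"
    proof -
      fix s t assume "k s t + edge_chain x y s t \<noteq> 0"
      then have "k s t \<noteq> 0 \<or> (edge_chain x y s t :: 'f) \<noteq> 0" by auto
      then show "s \<in> D \<and> t \<in> D"
        using xy k(2) unfolding edge_chain_def by (auto simp: of_bool_def split: if_splits)
    qed
    ultimately show "?P y"
      using chain1_add[OF k(1) chain1_edge_chain[of adj, OF xy(4) conjunct2[OF adj[OF xy(4)]]]]
      by (intro exI[of _ "\<lambda>s t. k s t + edge_chain x y s t"]) blast
  qed (use D in auto)
  then show thesis using that by blast
qed

text \<open>What the argument keeps of a flag homology 2-sphere. In \<open>edge_link\<close>,
  \<open>\<not> adj p q\<close> excludes four mutually adjacent vertices, which flagness would turn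
  into a 3-dimensional face.\<close>

locale surface_graph =
  fixes V :: "'a set" and adj :: "'a \<Rightarrow> 'a \<Rightarrow> bool" and Z :: "'a \<Rightarrow> 'a \<Rightarrow> 'a \<Rightarrow> 'f::field"
  assumes finite_V: "finite V"
    and adj_V: "adj x y \<Longrightarrow> x \<in> V"
    and adj_sym: "adj x y \<Longrightarrow> adj y x"
    and adj_irrefl: "\<not> adj x x"
    and connected_V: "cut_connected adj V"
    and edge_link: "adj x y \<Longrightarrow> \<exists>p q. p \<noteq> q \<and> \<not> adj p q \<and> (\<forall>t. adj x t \<and> adj y t \<longleftrightarrow> t = p \<or> t = q)"
    and connected_link: "x \<in> V \<Longrightarrow> cut_connected adj {t. adj x t}"
    and link_nonempty: "x \<in> V \<Longrightarrow> \<exists>t. adj x t"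
    and chain2_Z: "chain2 adj Z"
    and cycle_Z: "(\<Sum>t\<in>V. Z t x y) = 0"
    and Z_nonzero: "\<exists>x y z. Z x y z \<noteq> 0"
    and H1_vanishes: "\<And>k :: 'a \<Rightarrow> 'a \<Rightarrow> 'f. chain1 adj k \<Longrightarrow> (\<And>y. (\<Sum>t\<in>V. k t y) = 0) \<Longrightarrow>
       \<exists>e. chain2 adj e \<and> (\<forall>x y. (\<Sum>t\<in>V. e t x y) = k x y)"
begin

definition lk :: "'a \<Rightarrow> 'a set" where "lk x = {t. adj x t}"

lemma lk_V: "lk x \<subseteq> V"
  unfolding lk_def using adj_V adj_sym by blast

lemma adj_V_sym: "adj x y \<Longrightarrow> x \<in> V \<and> adj y x"
  using adj_V adj_sym by blast

lemma in_lk: "t \<in> lk x \<longleftrightarrow> adj x t"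
  unfolding lk_def by simp

lemma connected_lk: "x \<in> V \<Longrightarrow> cut_connected adj (lk x)"
  using connected_link unfolding lk_def .

lemma other_common_neighbour:
  assumes "adj x y" "adj x t" "adj y t"
  obtains s where "s \<noteq> t" "adj x s" "adj y s" "\<not> adj s t" "\<And>r. adj x r \<Longrightarrow> adj y r \<Longrightarrow> r = t \<or> r = s"
proof -
  obtain p q where pq: "p \<noteq> q" "\<not> adj p q" "\<And>t. adj x t \<and> adj y t \<longleftrightarrow> t = p \<or> t = q"
    using edge_link[OF assms(1)] by blast
  then have "\<not> adj q p" using adj_sym by blast
  show thesis
  proof (cases "t = p")
    case True
    show ?thesis by (rule that[of q]) (use True pq \<open>\<not> adj q p\<close> in auto)
  next
    case False
    then have "t = q" using assms pq by blast
    show ?thesis by (rule that[of p]) (use \<open>t = q\<close> pq in auto)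
  qed
qed

lemma three_common_neighbours:
  assumes "adj x y" "adj x p" "adj y p" "adj x q" "adj y q" "adj x r" "adj y r"
  shows "p = q \<or> p = r \<or> q = r"
proof -
  obtain a b where "\<And>t. adj x t \<and> adj y t \<longleftrightarrow> t = a \<or> t = b" using edge_link[OF assms(1)] by blast
  then have "p = a \<or> p = b" "q = a \<or> q = b" "r = a \<or> r = b" using assms by blast+
  then show ?thesis by blast
qed

lemma sum_at_edge:
  fixes e :: "'a \<Rightarrow> 'a \<Rightarrow> 'a \<Rightarrow> 'f"
  assumes "chain2 adj e" "adj x y" "adj x p" "adj y p" "adj x q" "adj y q" "p \<noteq> q"
  shows "(\<Sum>t\<in>V. e t x y) = e p x y + e q x y"
proof -
  have "(\<Sum>t\<in>V. e t x y) = (\<Sum>t\<in>{p, q}. e t x y)"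
  proof (rule sum.mono_neutral_right)
    show "\<forall>i\<in>V - {p, q}. e i x y = 0"
    proof (rule ballI, rule ccontr)
      fix i assume i: "i \<in> V - {p, q}" "e i x y \<noteq> 0"
      then have "adj x i" "adj y i" using chain2_support[OF assms(1)] adj_sym by blast+
      then show False using three_common_neighbours[OF assms(2-6)] i assms(7) by blast
    qed
  qed (use finite_V assms adj_V adj_sym in auto)
  then show ?thesis using assms(7) by simp
qed

text \<open>The two triangles at an edge through \<open>x\<close> contribute opposite values to a
  boundary that is zero there. A zero therefore crosses each such edge, and the connected link
  carries it all the way around \<open>x\<close>.\<close>

lemma vanishes_around_vertex:
  fixes e :: "'a \<Rightarrow> 'a \<Rightarrow> 'a \<Rightarrow> 'f"
  assumes e: "chain2 adj e" and closed: "\<And>y. (\<Sum>t\<in>V. e t x y) = 0"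
    and tri: "adj x p" "adj x q" "adj p q" and zero: "e x p q = 0"
  shows "e x y z = 0"
proof -
  have opp: "e x a s = 0" if "adj x a" "adj x b" "adj a b" "e x a b = 0" for a b s
  proof (rule ccontr)
    assume ne: "e x a s \<noteq> 0"
    then have s: "adj x s" "adj a s" "s \<noteq> b" using chain2_support[OF e] that by blast+
    have "e s x a + e b x a = 0"
      using sum_at_edge[OF e that(1) s(1,2) that(2,3) s(3)] closed[of a] by simp
    then show False using ne that(4) chain2_swap(5)[OF e, of x a s] chain2_swap(5)[OF e, of x a b] by simp
  qed
  have "\<forall>s. e x y s = 0" if y: "adj x y"
  proof (rule cut_connected_propagate[OF connected_lk, of x p "\<lambda>a. \<forall>s. e x a s = 0" y])
    show "x \<in> V" using tri adj_V by blast
    show "p \<in> lk x" "y \<in> lk x" using tri y by (simp_all add: in_lk)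
    show "\<forall>s. e x p s = 0" using opp[OF tri zero] by blast
    fix a b assume ab: "a \<in> lk x" "b \<in> lk x" "\<forall>s. e x a s = 0" "adj a b"
    then have "e x b a = 0" using chain2_swap(2)[OF e, of x b a] by simp
    then show "\<forall>s. e x b s = 0" using opp[of b a] ab adj_sym by (simp add: in_lk)
  qed
  then show ?thesis using chain2_support[OF e, of x y z] by blast
qed

text \<open>Adjacent vertices share a triangle, so a zero passes from one star to the next within
  \<open>W\<close>. Only the boundary at \<open>W\<close> enters, which suits
  \<open>connected_trace\<close>: there the boundary is a loop outside \<open>W\<close>.\<close>

lemma vanishes_around_connected:
  fixes e :: "'a \<Rightarrow> 'a \<Rightarrow> 'a \<Rightarrow> 'f"
  assumes e: "chain2 adj e" and closed: "\<And>x y. x \<in> W \<Longrightarrow> (\<Sum>t\<in>V. e t x y) = 0"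
    and W: "cut_connected adj W"
    and tri: "x \<in> W" "adj x p" "adj x q" "adj p q" and zero: "e x p q = 0" and y: "y \<in> W"
  shows "e y s t = 0"
proof -
  have "\<forall>s t. e y s t = 0"
  proof (rule cut_connected_propagate[OF W, of x "\<lambda>y. \<forall>s t. e y s t = 0" y])
    show "\<forall>s t. e x s t = 0" using vanishes_around_vertex[OF e closed tri(2-4) zero] tri(1) by blast
    fix a b assume ab: "a \<in> W" "b \<in> W" "\<forall>s t. e a s t = 0" "adj a b"
    obtain r where r: "adj a r" "adj b r" using edge_link[OF ab(4)] by blast
    have "e b a r = 0" using ab(3) chain2_swap(1)[OF e, of b a r] by simp
    then show "\<forall>s t. e b s t = 0"
      using vanishes_around_vertex[OF e closed, of b a r] ab r adj_sym by blast
  qed (use tri y in auto)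
  then show ?thesis by blast
qed

text \<open>A zero on one triangle would spread over the connected graph and make \<open>Z\<close>
  vanish.\<close>

lemma Z_triangle_nonzero:
  assumes "adj x y" "adj x z" "adj y z"
  shows "Z x y z \<noteq> 0"
proof
  assume "Z x y z = 0"
  then have "Z a b c = 0" if "a \<in> V" for a b c
    using vanishes_around_connected[OF chain2_Z cycle_Z connected_V _ assms] that assms adj_V by blast
  then show False using Z_nonzero chain2_support[OF chain2_Z] adj_V by blast
qed

end

section \<open>Separating cycles\<close>

text \<open>A discrete Stokes argument: the terms that leave \<open>T\<close> vanish, and those
  inside cancel in pairs.\<close>

lemma sum_antisymmetric_closed:
  fixes f :: "'a \<Rightarrow> 'a \<Rightarrow> 'f::field"
  assumes "finite V" "T \<subseteq> V" "\<And>x y. f x y = - f y x" "\<And>x. f x x = 0"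
    and "\<And>x t. x \<in> T \<Longrightarrow> t \<in> V - T \<Longrightarrow> f t x = 0"
  shows "(\<Sum>x\<in>T. \<Sum>t\<in>V. f t x) = 0"
proof -
  have "(\<Sum>x\<in>T. \<Sum>t\<in>V. f t x) = (\<Sum>x\<in>T. \<Sum>t\<in>T. f t x)"
    by (intro sum.cong refl sum.mono_neutral_right) (use assms(1,2,5) in auto)
  also have "\<dots> = (\<Sum>t\<in>T. \<Sum>x\<in>T. f t x)" by (rule sum.swap)
  also have "\<dots> = 0"
    by (rule sum_antisymmetric_zero[OF finite_subset[OF assms(2,1)] assms(3,4)])
  finally show ?thesis .
qed

text \<open>Growing a connected set by one vertex removes a boundary edge and adds at most one.\<close>

lemma boundary_of_connected_le_2:
  assumes "finite L" and deg: "\<And>p. p \<in> L \<Longrightarrow> card {q\<in>L. r p q} \<le> 2"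
    and S: "S \<subseteq> L" "cut_connected r S" "S \<noteq> {}" and sym: "\<And>x y. r x y \<Longrightarrow> r y x"
  shows "card {(p, q). p \<in> S \<and> q \<in> L - S \<and> r p q} \<le> 2"
proof -
  define bd where "bd S = {(p, q). p \<in> S \<and> q \<in> L - S \<and> r p q}" for S
  have finite_bd: "finite (bd T)" if "T \<subseteq> L" for T
    by (rule finite_subset[of _ "L \<times> L"]) (use that assms(1) in \<open>auto simp: bd_def\<close>)
  define F where "F = {T. T \<subseteq> S \<and> T \<noteq> {} \<and> card (bd T) \<le> 2}"
  have "finite S" using S(1) assms(1) finite_subset by blast
  then have "finite F" unfolding F_def by simp
  obtain s where s: "s \<in> S" using S(3) by blast
  have "card (bd {s}) \<le> card ({s} \<times> {q\<in>L. r s q})"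
    by (rule card_mono) (use assms(1) in \<open>auto simp: bd_def\<close>)
  also have "\<dots> \<le> 2" using deg[of s] s S(1) by (auto simp: card_cartesian_product)
  finally have "{s} \<in> F" using s unfolding F_def by simp
  then obtain T where T: "T \<in> F" "\<And>T'. T' \<in> F \<Longrightarrow> T \<subseteq> T' \<Longrightarrow> T' = T"
    using finite_has_maximal2[OF \<open>finite F\<close>] by metis
  have "T = S"
  proof (rule ccontr)
    assume "T \<noteq> S"
    then obtain p t where pt: "p \<in> T" "t \<in> S" "t \<notin> T" "r p t"
      using cut_connectedD[OF S(2), of T] T(1) unfolding F_def by blast
    have TL: "T \<subseteq> L" "t \<in> L" "p \<in> L" using T(1) S(1) pt unfolding F_def by blast+
    have "bd (insert t T) \<subseteq> (bd T - {(p, t)}) \<union> {t} \<times> ({q\<in>L. r t q} - {p})"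
      using pt unfolding bd_def by auto
    then have "card (bd (insert t T)) \<le> card ((bd T - {(p, t)}) \<union> {t} \<times> ({q\<in>L. r t q} - {p}))"
      by (rule card_mono[rotated]) (use finite_bd[OF TL(1)] assms(1) in auto)
    also have "\<dots> \<le> card (bd T - {(p, t)}) + card ({t} \<times> ({q\<in>L. r t q} - {p}))"
      by (rule card_Un_le)
    also have "card (bd T - {(p, t)}) \<le> 1"
    proof -
      have "(p, t) \<in> bd T" using pt TL unfolding bd_def by auto
      then show ?thesis using T(1) finite_bd[OF TL(1)] unfolding F_def by (auto simp: card_Diff_singleton)
    qed
    also have "card ({t} \<times> ({q\<in>L. r t q} - {p})) \<le> 1"
    proof -
      have "p \<in> {q\<in>L. r t q}" using pt TL sym by blast
      then show ?thesis using deg[OF TL(2)] assms(1) by (simp add: card_cartesian_product card_Diff_singleton)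
    qed
    finally have "insert t T \<in> F" using T(1) pt(2) unfolding F_def by simp
    then show False using T(2)[of "insert t T"] pt(3) by blast
  qed
  then show ?thesis using T(1) unfolding F_def bd_def by blast
qed

context surface_graph
begin

text \<open>If \<open>T\<close> were a union of components of the trace, close a path in \<open>D\<close> from inside \<open>T\<close> to
  outside \<open>T\<close> through \<open>c\<close>. The resulting cycle bounds a 2-chain, and subtracting a multiple of \<open>Z\<close>
  makes this 2-chain vanish on the triangles meeting the connected set \<open>W\<close>. Pairing with the edges
  from \<open>c\<close> to \<open>T\<close> then gives both 1 and 0.\<close>

lemma connected_trace:
  assumes c: "c \<in> V" and part: "D \<union> W = V - {c}" "D \<inter> W = {}"
    and D: "cut_connected adj D" and W: "cut_connected adj W" "W \<noteq> {}"
  shows "cut_connected adj (lk c \<inter> D)"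
  unfolding cut_connected_def
proof (intro allI impI, rule ccontr)
  fix T assume T: "T \<subseteq> lk c \<inter> D" "T \<noteq> {}" "T \<noteq> lk c \<inter> D"
    and no: "\<not> (\<exists>a\<in>T. \<exists>b\<in>lk c \<inter> D - T. adj a b)"
  obtain a b where ab: "a \<in> T" "b \<in> lk c \<inter> D" "b \<notin> T" using T by blast
  have aD: "a \<in> D" "b \<in> D" "adj c a" "adj c b" using ab T by (auto simp: in_lk)
  have neq: "c \<noteq> a" "c \<noteq> b" "a \<noteq> b" "c \<notin> D" "c \<notin> W" using aD part ab by blast+
  have V: "a \<in> V" "b \<in> V" using aD part by blast+
  obtain p where p: "chain1 adj p" "\<And>x y. p x y \<noteq> 0 \<Longrightarrow> x \<in> D \<and> y \<in> D"
    "\<And>y. (\<Sum>t\<in>V. p t y) = (of_bool (y = b) - of_bool (y = a) :: 'f)"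
    using path_chain[OF finite_V adj_V_sym D aD(1,2)] by blast
  define k where "k x y = p x y + (edge_chain c a x y + edge_chain b c x y)" for x y
  have k1: "chain1 adj k"
    unfolding k_def by (intro chain1_add p chain1_edge_chain aD adj_sym[OF aD(3)] adj_sym[OF aD(4)])
  have k2: "(\<Sum>t\<in>V. k t y) = 0" for y
    unfolding k_def by (simp add: sum.distrib p(3) sum_edge_chain[OF finite_V] V c)
  obtain e where e: "chain2 adj e" "\<And>x y. (\<Sum>t\<in>V. e t x y) = k x y"
    using H1_vanishes[OF k1 k2] by blast
  obtain w where w: "w \<in> W" using W by blast
  then obtain s where s: "adj w s" using link_nonempty part by blast
  then obtain t where t: "adj w t" "adj s t" using edge_link by blast
  \<comment> \<open>The scalar for which \<open>g\<close> vanishes on the triangle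
    \<open>w s t\<close>; from there the zero spreads over \<open>W\<close>.\<close>
  define l where "l = e w s t / Z w s t"
  define g where "g x y z = e x y z - l * Z x y z" for x y z
  have g: "chain2 adj g"
    unfolding chain2_def
  proof (intro allI conjI impI)
    fix x y z
    show "g x y z = - g y x z" "g x y z = - g x z y"
      unfolding g_def using chain2_swap(1,2)[OF e(1), of x y z] chain2_swap(1,2)[OF chain2_Z, of x y z]
      by simp_all
    assume "g x y z \<noteq> 0"
    then have "e x y z \<noteq> 0 \<or> Z x y z \<noteq> 0" unfolding g_def by auto
    then show "adj x y" "adj y z" "adj x z"
      using chain2_support[OF e(1)] chain2_support[OF chain2_Z] by blast+
  qed
  have bg: "(\<Sum>t\<in>V. g t x y) = k x y" for x y
    unfolding g_def by (simp add: sum_subtractf e(2) sum_distrib_left[symmetric] cycle_Z)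
  have k_supp: "k x y = 0" if "x \<in> W" for x y
  proof -
    have "x \<notin> D" "x \<noteq> a" "x \<noteq> b" "x \<noteq> c" using that part aD by blast+
    then show ?thesis using p(2)[of x y] unfolding k_def edge_chain_def by auto
  qed
  have gW: "g y x z = 0" if "y \<in> W" for x y z
  proof (rule vanishes_around_connected[OF g _ W(1) w s t _ that])
    show "g w s t = 0" unfolding g_def l_def using Z_triangle_nonzero[OF s t] by simp
    show "(\<Sum>t\<in>V. g t x y) = 0" if "x \<in> W" for x y using bg k_supp that by simp
  qed
  \<comment> \<open>Let \<open>t c x\<close> be a triangle in the support of \<open>g\<close> with
    \<open>x\<close> in \<open>T\<close> and \<open>t\<close> outside \<open>T\<close>. Then
    \<open>t\<close> is not in \<open>W\<close>, where \<open>g\<close> vanishes, so it lies in the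
    trace and is adjacent to \<open>x\<close>, against the choice of \<open>T\<close>.\<close>
  have "(\<Sum>x\<in>T. \<Sum>t\<in>V. g t c x) = 0"
  proof (rule sum_antisymmetric_closed[OF finite_V])
    show "T \<subseteq> V" using T part by blast
    show "g x c y = - g y c x" for x y by (rule chain2_swap(3)[OF g])
    show "g x c x = 0" for x using chain2_support[OF g, of x c x] adj_irrefl by blast
    fix x t assume xt: "x \<in> T" "t \<in> V - T"
    show "g t c x = 0"
    proof (rule ccontr)
      assume ne: "g t c x \<noteq> 0"
      then have "t \<noteq> c" "adj c t" "adj x t" using chain2_support[OF g] adj_irrefl adj_sym by blast+
      moreover have "t \<notin> W" using gW[of t c x] ne by auto
      ultimately have "t \<in> lk c \<inter> D - T" using part xt(2) in_lk by blast
      then show False using no xt(1) \<open>adj x t\<close> by blast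
    qed
  qed
  moreover have "(\<Sum>x\<in>T. \<Sum>t\<in>V. g t c x) = (\<Sum>x\<in>T. of_bool (x = a))"
  proof (rule sum.cong[OF refl])
    fix x assume "x \<in> T"
    then have "p c x = 0" "x \<noteq> b" "x \<noteq> c" using p(2) neq T ab by blast+
    then show "(\<Sum>t\<in>V. g t c x) = of_bool (x = a)"
      unfolding bg k_def edge_chain_def using neq by simp
  qed
  moreover have "(\<Sum>x\<in>T. of_bool (x = a)) = (1 :: 'f)"
  proof -
    have "finite T" using T part finite_V finite_subset by (metis Diff_subset le_inf_iff sup_ge1)
    then show ?thesis using ab(1) by (simp add: of_bool_def)
  qed
  ultimately show False by simp
qed

text \<open>\<open>connected_trace\<close> needs a partition of \<open>V - {c}\<close>; this
  provides one from two disjoint connected sets. \<open>W\<close> grows to its component outside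
  \<open>D\<close>, and \<open>D'\<close> takes the rest. A piece of \<open>D'\<close> not joined to
  \<open>D\<close> could be adjacent to nothing but \<open>c\<close>. As the link of
  \<open>c\<close> is connected and meets \<open>D\<close>, it misses that piece, which then
  contradicts connectedness of \<open>V\<close>.\<close>

lemma enlarge_connected_trace:
  assumes c: "c \<in> V" and D: "cut_connected adj D" "D \<subseteq> V - {c}" "lk c \<inter> D \<noteq> {}"
    and W: "cut_connected adj W" "W \<subseteq> V - {c}" "W \<noteq> {}" and disj: "D \<inter> W = {}"
  obtains D' where "D \<subseteq> D'" "D' \<subseteq> V - {c}" "D' \<inter> W = {}" "cut_connected adj (lk c \<inter> D')"
proof -
  obtain w where w: "w \<in> W" using W by blast
  define S where "S = V - insert c D"
  define W' where "W' = component adj S w"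
  define D' where "D' = V - {c} - W'"
  have wS: "w \<in> S" "W \<subseteq> S" using w W disj unfolding S_def by blast+
  have WW: "W \<subseteq> W'" unfolding W'_def by (rule component_greatest[OF wS(2) w W(1)])
  have WS: "W' \<subseteq> S" unfolding W'_def by (rule component_subset)
  have W'c: "cut_connected adj W'" unfolding W'_def by (rule component_connected[OF adj_sym])
  have W'closed: "y \<in> W'" if "x \<in> W'" "y \<in> S" "adj x y" for x y
    unfolding W'_def by (rule component_closed[OF adj_sym wS(1) that[unfolded W'_def]])
  have DD: "D \<subseteq> D'" using D WS unfolding D'_def S_def by blast
  obtain d where d: "d \<in> D" "adj c d" using D(3) by (auto simp: in_lk)
  define U where "U = component adj D' d"
  have DU: "D \<subseteq> U" unfolding U_def by (rule component_greatest[OF DD d(1) D(1)])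
  have UD: "U \<subseteq> D'" unfolding U_def by (rule component_subset)
  have Uclosed: "y \<in> U" if "x \<in> U" "y \<in> D'" "adj x y" for x y
    unfolding U_def by (rule component_closed[OF adj_sym _ that[unfolded U_def]]) (use d DD in blast)+
  have out: "y \<in> D' - U \<or> y = c" if "x \<in> D' - U" "adj x y" for x y
  proof -
    have yV: "y \<in> V" using that adj_V adj_sym by blast
    have xS: "x \<in> S" using that DU unfolding D'_def S_def by blast
    have "y \<notin> W'" using W'closed[OF _ xS adj_sym[OF that(2)]] that(1) unfolding D'_def by blast
    moreover have "y \<notin> U" using Uclosed[OF _ _ adj_sym[OF that(2)]] that(1) by blast
    ultimately show ?thesis using yV unfolding D'_def by blast
  qed
  have "lk c \<inter> (D' - U) = {}"
  proof (rule ccontr)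
    assume "lk c \<inter> (D' - U) \<noteq> {}"
    moreover have "lk c \<inter> (D' - U) \<noteq> lk c" using d DU by (auto simp: in_lk)
    ultimately obtain x y where "x \<in> lk c \<inter> (D' - U)" "y \<in> lk c" "y \<notin> lk c \<inter> (D' - U)" "adj x y"
      using cut_connectedD[OF connected_lk[OF c], of "lk c \<inter> (D' - U)"] by blast
    then show False using out adj_irrefl by (auto simp: in_lk)
  qed
  then have no_c: "\<not> adj x c" if "x \<in> D' - U" for x using that adj_sym in_lk by blast
  have "D' - U = {}"
  proof (rule ccontr)
    assume "D' - U \<noteq> {}"
    moreover have "D' - U \<subseteq> V" "D' - U \<noteq> V" using c unfolding D'_def by blast+
    ultimately obtain x y where "x \<in> D' - U" "y \<notin> D' - U" "adj x y"
      by (metis cut_connectedD[OF connected_V])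
    then show False using out no_c by blast
  qed
  then have "D' = U" using UD by blast
  moreover have "cut_connected adj U" unfolding U_def by (rule component_connected[OF adj_sym])
  ultimately have "cut_connected adj D'" by simp
  then have "cut_connected adj (lk c \<inter> D')"
    by (rule connected_trace[OF c _ _ _ W'c, rotated 2])
       (use WW W(3) WS in \<open>auto simp: D'_def S_def\<close>)
  then show thesis by (rule that[rotated 3]) (use DD WW in \<open>auto simp: D'_def\<close>)
qed

end

text \<open>\<open>C\<close> is a minimal separator of \<open>A\<close> from \<open>B\<close>: each
  of its vertices has neighbours on both sides. The three sets may leave out further vertices of
  \<open>V\<close>; \<open>lk_subset\<close> shows that those are not adjacent to
  \<open>C\<close>.\<close>

locale separation = surface_graph V adj Z
  for V :: "'a set" and adj and Z :: "'a \<Rightarrow> 'a \<Rightarrow> 'a \<Rightarrow> 'f::field" +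
  fixes A B C :: "'a set"
  assumes sub: "A \<subseteq> V" "B \<subseteq> V" "C \<subseteq> V"
    and disj: "A \<inter> B = {}" "A \<inter> C = {}" "B \<inter> C = {}"
    and ne: "A \<noteq> {}" "B \<noteq> {}"
    and connected_A: "cut_connected adj A" and connected_B: "cut_connected adj B"
    and closed_A: "a \<in> A \<Longrightarrow> adj a y \<Longrightarrow> y \<in> A \<union> C"
    and closed_B: "b \<in> B \<Longrightarrow> adj b y \<Longrightarrow> y \<in> B \<union> C"
    and touch_A: "c \<in> C \<Longrightarrow> \<exists>a\<in>A. adj a c"
    and touch_B: "c \<in> C \<Longrightarrow> \<exists>b\<in>B. adj b c"
begin

lemma swap: "separation V adj Z B A C"
  by unfold_locales (use sub disj ne connected_A connected_B closed_A closed_B touch_A touch_B in auto)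

lemma connected_B_Un: "T \<subseteq> C \<Longrightarrow> cut_connected adj (B \<union> T)"
  by (rule cut_connected_attach[OF connected_B _ ne(2) adj_sym]) (use touch_B in auto)

text \<open>The trace of \<open>A \<union> {x}\<close> on the link of \<open>c\<close> is connected, so that \<open>x\<close> is adjacent in this link
  to an element of \<open>A\<close>.\<close>

lemma common_neighbour_A:
  assumes "c \<in> C" "x \<in> C" "adj c x"
  obtains a where "a \<in> A" "adj c a" "adj x a"
proof -
  obtain a0 a1 where a0: "a0 \<in> A" "adj a0 x" and a1: "a1 \<in> A" "adj a1 c"
    using touch_A assms by blast
  have "c \<noteq> x" using assms(3) adj_irrefl by blast
  have "cut_connected adj (insert x A)"
    by (rule cut_connected_insert[OF connected_A a0 adj_sym])
  \<comment> \<open>The opposite set takes all of \<open>C\<close> except \<open>x\<close> and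
    \<open>c\<close>, so that the enlarged set \<open>D'\<close> meets \<open>C\<close> only in
    \<open>x\<close>.\<close>
  moreover have "cut_connected adj (B \<union> (C - {x, c}))" by (rule connected_B_Un) blast
  moreover have cV: "c \<in> V" and "insert x A \<subseteq> V - {c}" "B \<union> (C - {x, c}) \<subseteq> V - {c}" "B \<union> (C - {x, c}) \<noteq> {}"
    "insert x A \<inter> (B \<union> (C - {x, c})) = {}"
    using assms sub disj ne \<open>c \<noteq> x\<close> by blast+
  moreover have "lk c \<inter> insert x A \<noteq> {}" using assms(3) in_lk by blast
  ultimately obtain D' where D': "insert x A \<subseteq> D'" "D' \<subseteq> V - {c}" "D' \<inter> (B \<union> (C - {x, c})) = {}"
    "cut_connected adj (lk c \<inter> D')"
    using enlarge_connected_trace[OF cV, of "insert x A" "B \<union> (C - {x, c})"] by metis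
  have "lk c \<inter> A \<subseteq> lk c \<inter> D'" "lk c \<inter> A \<noteq> {}" "lk c \<inter> A \<noteq> lk c \<inter> D'"
  proof -
    show "lk c \<inter> A \<subseteq> lk c \<inter> D'" using D'(1) by blast
    show "lk c \<inter> A \<noteq> {}" using adj_sym[OF a1(2)] a1(1) in_lk by blast
    have "x \<in> lk c \<inter> D'" using D'(1) assms(3) in_lk by blast
    moreover have "x \<notin> A" using assms(2) disj by blast
    ultimately show "lk c \<inter> A \<noteq> lk c \<inter> D'" by blast
  qed
  then obtain a b where ab: "a \<in> lk c \<inter> A" "b \<in> lk c \<inter> D'" "b \<notin> lk c \<inter> A" "adj a b"
    using cut_connectedD[OF D'(4)] by blast
  then have "b \<in> C" using closed_A by blast
  then have "b = x" using ab D'(2,3) by blast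
  then show thesis using that[of a] ab adj_sym by (auto simp: in_lk)
qed

text \<open>The enlargement \<open>D'\<close> may exceed \<open>A\<close>, but it avoids
  \<open>C\<close>, and an edge leaving \<open>A\<close> can end only in \<open>C\<close>. So the
  edges provided by the connected trace of \<open>D'\<close> stay inside \<open>A\<close>.\<close>

lemma connected_trace_A:
  assumes c: "c \<in> C"
  shows "cut_connected adj (lk c \<inter> A)"
proof -
  obtain a1 where a1: "a1 \<in> A" "adj a1 c" using touch_A c by blast
  have "cut_connected adj (B \<union> (C - {c}))" by (rule connected_B_Un) blast
  moreover have "lk c \<inter> A \<noteq> {}" using a1 adj_sym in_lk by blast
  moreover have cV: "c \<in> V" and "A \<subseteq> V - {c}" "B \<union> (C - {c}) \<subseteq> V - {c}" "B \<union> (C - {c}) \<noteq> {}"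
    "A \<inter> (B \<union> (C - {c})) = {}"
    using c sub disj ne by blast+
  ultimately obtain D' where D': "A \<subseteq> D'" "D' \<subseteq> V - {c}" "D' \<inter> (B \<union> (C - {c})) = {}"
    "cut_connected adj (lk c \<inter> D')"
    using enlarge_connected_trace[OF cV connected_A, of "B \<union> (C - {c})"] by metis
  show ?thesis
    unfolding cut_connected_def
  proof (intro allI impI)
    fix T assume T: "T \<subseteq> lk c \<inter> A" "T \<noteq> {}" "T \<noteq> lk c \<inter> A"
    then have "T \<subseteq> lk c \<inter> D'" "T \<noteq> lk c \<inter> D'" using D'(1) by blast+
    then obtain a b where ab: "a \<in> T" "b \<in> lk c \<inter> D'" "b \<notin> T" "adj a b"
      using cut_connectedD[OF D'(4) _ T(2)] by metis
    then have "b \<in> A" using closed_A[of a b] T(1) D'(2,3) by blast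
    then show "\<exists>a\<in>T. \<exists>b\<in>lk c \<inter> A - T. adj a b" using ab by blast
  qed
qed

text \<open>Each side supplies one common neighbour, and an edge has no more than two.\<close>

lemma common_neighbours:
  assumes "c \<in> C" "x \<in> C" "adj c x"
  obtains a b where "a \<in> A" "b \<in> B" "adj c a" "adj x a" "adj c b" "adj x b"
    "\<And>t. adj c t \<Longrightarrow> adj x t \<Longrightarrow> t = a \<or> t = b"
proof -
  interpret S: separation V adj Z B A C by (rule swap)
  obtain a where a: "a \<in> A" "adj c a" "adj x a" using common_neighbour_A[OF assms] by blast
  obtain b where b: "b \<in> B" "adj c b" "adj x b" using S.common_neighbour_A[OF assms] by blast
  have "a \<noteq> b" using a b disj by blast
  then show thesis
    using that[OF a(1) b(1) a(2,3) b(2,3)] three_common_neighbours[OF assms(3) a(2,3) b(2,3)] by blast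
qed

lemma triangle_free:
  assumes "c \<in> C" "x \<in> C" "adj c x" "adj c y" "adj x y"
  shows "y \<notin> C"
  using common_neighbours[OF assms(1-3)] assms(4,5) disj by (metis IntI emptyE)

text \<open>A part of the link outside the three sets would be joined within the link to some
  \<open>y\<close> in \<open>C\<close>; but the common neighbours of the edge \<open>c y\<close> lie
  in \<open>A\<close> and \<open>B\<close>.\<close>

lemma lk_subset:
  assumes c: "c \<in> C"
  shows "lk c \<subseteq> A \<union> B \<union> C"
proof (rule ccontr)
  let ?T = "lk c - (A \<union> B \<union> C)"
  assume "\<not> ?thesis"
  then have "?T \<subseteq> lk c" "?T \<noteq> {}" by blast+
  moreover have "?T \<noteq> lk c" using touch_A[OF c] adj_sym in_lk by blast
  moreover have "c \<in> V" using c sub by blast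
  ultimately obtain t y where ty: "t \<in> ?T" "y \<in> lk c" "y \<notin> ?T" "adj t y"
    using cut_connectedD[OF connected_lk, of c ?T] by metis
  then have "y \<in> C" using closed_A closed_B adj_sym[OF ty(4)] by blast
  then obtain a b where "a \<in> A" "b \<in> B" "t = a \<or> t = b"
    using common_neighbours[OF c, of y] ty adj_sym by (metis Diff_iff in_lk)
  then show False using ty(1) by blast
qed

text \<open>The boundary of the part of \<open>Z\<close> on the \<open>A\<close>-side: the fundamental cycle of \<open>C\<close>.\<close>

definition kappa :: "'a \<Rightarrow> 'a \<Rightarrow> 'f" where
  "kappa x y = (if x \<in> C \<and> y \<in> C then \<Sum>a\<in>A. Z a x y else 0)"

lemma chain1_kappa: "chain1 adj kappa"
  unfolding chain1_def
proof (intro allI conjI impI)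
  fix x y
  have "(\<Sum>a\<in>A. Z a x y) = - (\<Sum>a\<in>A. Z a y x)"
    by (subst sum_negf[symmetric]) (rule sum.cong[OF refl chain2_swap(2)[OF chain2_Z]])
  then show "kappa x y = - kappa y x" unfolding kappa_def by simp
  assume "kappa x y \<noteq> 0"
  then have "(\<Sum>a\<in>A. Z a x y) \<noteq> 0" unfolding kappa_def by meson
  then obtain a where "Z a x y \<noteq> 0" by (rule sum.not_neutral_contains_not_neutral)
  then show "adj x y" using chain2_support[OF chain2_Z] by blast
qed

text \<open>Of the two triangles at an edge of \<open>C\<close>, exactly one has its third vertex in
  \<open>A\<close>; the sum reduces to the value of \<open>Z\<close> on it.\<close>

lemma kappa_nonzero:
  assumes "c \<in> C" "x \<in> C" "adj c x"
  shows "kappa c x \<noteq> 0"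
proof -
  obtain a b where ab: "a \<in> A" "b \<in> B" "adj c a" "adj x a" "adj c b" "adj x b"
    "\<And>t. adj c t \<Longrightarrow> adj x t \<Longrightarrow> t = a \<or> t = b"
    by (rule common_neighbours[OF assms]) blast
  have "(\<Sum>a\<in>A. Z a c x) = (\<Sum>a\<in>{a}. Z a c x)"
  proof (rule sum.mono_neutral_right)
    show "\<forall>i\<in>A - {a}. Z i c x = 0"
    proof (intro ballI, rule ccontr)
      fix i assume i: "i \<in> A - {a}" "Z i c x \<noteq> 0"
      then have "adj c i" "adj x i" using chain2_support[OF chain2_Z] adj_sym by blast+
      then show False using ab(7)[of i] i(1) ab(2) disj by blast
    qed
  qed (use sub finite_V ab finite_subset in auto)
  also have "\<dots> \<noteq> 0" using Z_triangle_nonzero[of a c x] ab adj_sym assms by simp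
  finally show ?thesis using assms unfolding kappa_def by simp
qed

text \<open>The boundary of a boundary: when the vanishing boundary of \<open>Z\<close> is summed
  over the edges between \<open>A\<close> and \<open>c\<close>, the triangles with two vertices in
  \<open>A\<close> cancel, and the boundary of \<open>kappa\<close> at \<open>c\<close>
  remains.\<close>

lemma kappa_cycle: "(\<Sum>x\<in>V. kappa x c) = 0"
proof (cases "c \<in> C")
  case True
  have fin: "finite A" "finite C" using sub finite_V finite_subset by blast+
  have z: "(\<Sum>x\<in>A. Z a x c) + (\<Sum>x\<in>C. Z a x c) = 0" if "a \<in> A" for a
  proof -
    have "(\<Sum>x\<in>A. Z a x c) + (\<Sum>x\<in>C. Z a x c) = (\<Sum>x\<in>A \<union> C. Z a x c)"
      by (rule sum.union_disjoint[symmetric]) (use fin disj in auto)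
    also have "\<dots> = (\<Sum>x\<in>V. Z a x c)"
      by (rule sum.mono_neutral_left)
         (use finite_V sub chain2_support[OF chain2_Z] closed_A that in blast)+
    also have "\<dots> = (\<Sum>x\<in>V. - Z x a c)"
      by (rule sum.cong[OF refl]) (rule chain2_swap(1)[OF chain2_Z])
    also have "\<dots> = 0" by (simp add: sum_negf cycle_Z)
    finally show ?thesis .
  qed
  have "(\<Sum>a\<in>A. \<Sum>x\<in>A. Z a x c) = 0"
    by (rule sum_antisymmetric_zero[OF fin(1) chain2_swap(1)[OF chain2_Z]])
       (use chain2_support[OF chain2_Z] adj_irrefl in blast)
  then have "(\<Sum>a\<in>A. \<Sum>x\<in>C. Z a x c) = (\<Sum>a\<in>A. (\<Sum>x\<in>A. Z a x c) + (\<Sum>x\<in>C. Z a x c))"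
    by (simp add: sum.distrib)
  also have "\<dots> = 0" using z by simp
  finally have *: "(\<Sum>a\<in>A. \<Sum>x\<in>C. Z a x c) = 0" .
  have "(\<Sum>x\<in>V. kappa x c) = (\<Sum>x\<in>C. kappa x c)"
    by (rule sum.mono_neutral_right) (use finite_V sub in \<open>auto simp: kappa_def\<close>)
  also have "\<dots> = (\<Sum>x\<in>C. \<Sum>a\<in>A. Z a x c)"
    by (rule sum.cong[OF refl]) (use True in \<open>simp add: kappa_def\<close>)
  also have "\<dots> = 0" using * by (subst sum.swap)
  finally show ?thesis .
next
  case False
  then show ?thesis unfolding kappa_def by simp
qed

text \<open>With no neighbour in \<open>C\<close>, the link of \<open>c\<close> would fall apart
  into its parts in \<open>A\<close> and \<open>B\<close>; with only one, the cycle
  \<open>kappa\<close> would have a single nonzero edge at \<open>c\<close>. For the upper bound,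
  each neighbour in \<open>C\<close> is the outer end of a boundary edge of the connected trace
  \<open>lk c \<inter> A\<close>, and in the link, where degrees are at most 2, there are at most
  two such edges.\<close>

lemma degree_2:
  assumes c: "c \<in> C"
  shows "card {x\<in>C. adj c x} = 2"
proof -
  let ?N = "{x\<in>C. adj c x}"
  have cV: "c \<in> V" using c sub by blast
  have finN: "finite ?N" using sub(3) finite_V by (auto intro: finite_subset)
  have "?N \<noteq> {}"
  proof
    assume "?N = {}"
    then have lkc: "lk c \<subseteq> A \<union> B" using lk_subset[OF c] by (auto simp: in_lk)
    have "lk c \<inter> A \<noteq> {}" "lk c \<inter> A \<noteq> lk c"
      using touch_A[OF c] touch_B[OF c] disj adj_sym in_lk by blast+
    then obtain x y where "x \<in> lk c \<inter> A" "y \<in> lk c" "y \<notin> lk c \<inter> A" "adj x y"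
      using cut_connectedD[OF connected_lk[OF cV] Int_lower1] by metis
    then show False using closed_A[of x y] lkc disj \<open>?N = {}\<close> by (auto simp: in_lk)
  qed
  moreover have "card ?N \<noteq> 1"
  proof
    assume "card ?N = 1"
    then obtain x where x: "?N = {x}" using card_1_singletonE by blast
    have "(\<Sum>y\<in>V. kappa y c) = (\<Sum>y\<in>{x}. kappa y c)"
    proof (rule sum.mono_neutral_right)
      show "\<forall>i\<in>V - {x}. kappa i c = 0"
      proof (intro ballI, rule ccontr)
        fix i assume i: "i \<in> V - {x}" "kappa i c \<noteq> 0"
        then have "i \<in> C" unfolding kappa_def by meson
        moreover have "adj i c" using i(2) chain1_kappa unfolding chain1_def by blast
        ultimately show False using i(1) x adj_sym by blast
      qed
    qed (use finite_V x sub in auto)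
    also have "\<dots> = kappa x c" by simp
    also have "\<dots> \<noteq> 0" using kappa_nonzero[of x c] x c adj_sym by blast
    finally show False using kappa_cycle by blast
  qed
  moreover have "card ?N \<le> 2"
  proof -
    let ?L = "lk c" and ?S = "lk c \<inter> A"
    have finL: "finite ?L" using lk_V finite_V finite_subset by blast
    have deg: "card {q\<in>?L. adj p q} \<le> 2" if p: "p \<in> ?L" for p
    proof -
      obtain s t where "\<And>q. adj c q \<and> adj p q \<longleftrightarrow> q = s \<or> q = t"
        using edge_link[of c p] p by (auto simp: in_lk)
      then have "{q\<in>?L. adj p q} = {s, t}" by (auto simp: in_lk)
      then show ?thesis by (simp add: card_insert_if)
    qed
    have "?S \<noteq> {}" using touch_A[OF c] adj_sym in_lk by blast
    then have le: "card {(p, q). p \<in> ?S \<and> q \<in> ?L - ?S \<and> adj p q} \<le> 2"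
      using boundary_of_connected_le_2[OF finL deg _ connected_trace_A[OF c] _ adj_sym] by blast
    have ex: "\<exists>a. a \<in> ?S \<and> adj a x" if "x \<in> ?N" for x
      using common_neighbour_A[OF c, of x] that adj_sym by (metis IntI in_lk mem_Collect_eq)
    have "?N \<subseteq> snd ` {(p, q). p \<in> ?S \<and> q \<in> ?L - ?S \<and> adj p q}"
    proof
      fix x assume x: "x \<in> ?N"
      then obtain a where "a \<in> ?S" "adj a x" using ex by blast
      then show "x \<in> snd ` {(p, q). p \<in> ?S \<and> q \<in> ?L - ?S \<and> adj p q}"
        using x disj by (intro image_eqI[of _ _ "(a, x)"]) (auto simp: in_lk)
    qed
    then have "card ?N \<le> card {(p, q). p \<in> ?S \<and> q \<in> ?L - ?S \<and> adj p q}"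
      by (rule surj_card_le[rotated]) (rule finite_subset[of _ "?L \<times> ?L"], use finL in auto)
    then show ?thesis using le by simp
  qed
  ultimately show ?thesis using finN by (metis card_0_eq le_SucE le_zero_eq numeral_2_eq_2 One_nat_def)
qed

lemma C_nonempty: "C \<noteq> {}"
proof -
  obtain x y where "x \<in> A" "y \<notin> A" "adj x y"
  proof (rule cut_connectedD[OF connected_V sub(1) ne(1)])
    show "A \<noteq> V" using sub ne disj by blast
  qed blast
  then show ?thesis using closed_A by blast
qed

text \<open>Being adjacent to \<open>C\<close>, \<open>t\<close> lies on one of the sides. A second
  vertex on that side would force a neighbour of \<open>t\<close> there, while all its neighbours
  are in \<open>C\<close>.\<close>

lemma C_eq_lk:
  assumes "t \<in> V" "C = lk t"
  shows "A = {t} \<or> B = {t}"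
proof -
  obtain c where c: "c \<in> C" using C_nonempty by blast
  then have "t \<in> A \<union> B \<union> C" using lk_subset[OF c] assms adj_sym in_lk by blast
  moreover have "t \<notin> C" using assms adj_irrefl in_lk by blast
  ultimately consider "t \<in> A" | "t \<in> B" by blast
  then show ?thesis
  proof cases
    case 1
    have "A = {t}"
    proof (rule ccontr)
      assume "A \<noteq> {t}"
      then obtain y where "y \<in> A" "adj t y"
        using cut_connectedD[OF connected_A, of "{t}"] 1 by (metis empty_subsetI insert_not_empty insert_subset singletonD)
      then show False using assms(2) disj in_lk by blast
    qed
    then show ?thesis ..
  next
    case 2
    have "B = {t}"
    proof (rule ccontr)
      assume "B \<noteq> {t}"
      then obtain y where "y \<in> B" "adj t y"
        using cut_connectedD[OF connected_B, of "{t}"] 2 by (metis empty_subsetI insert_not_empty insert_subset singletonD)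
      then show False using assms(2) disj in_lk by blast
    qed
    then show ?thesis ..
  qed
qed

text \<open>If no edge joins \<open>T\<close> to \<open>C - T\<close>, the edges between
  \<open>A\<close> and \<open>T\<close> behave like a cocycle: a triangle containing one of them
  contains exactly two. A loop that goes from \<open>A\<close> to \<open>B\<close> across
  \<open>T\<close> and returns across \<open>C - T\<close> uses one of these edges only, although it
  bounds.\<close>

lemma connected_C: "cut_connected adj C"
  unfolding cut_connected_def
proof (intro allI impI, rule ccontr)
  fix T assume T: "T \<subseteq> C" "T \<noteq> {}" "T \<noteq> C" and no: "\<not> (\<exists>a\<in>T. \<exists>b\<in>C - T. adj a b)"
  obtain c1 c2 where c: "c1 \<in> T" "c2 \<in> C" "c2 \<notin> T" using T by blast
  have c1: "c1 \<in> C" using T c by blast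
  obtain a1 a2 where a: "a1 \<in> A" "adj a1 c1" "a2 \<in> A" "adj a2 c2"
    using touch_A[OF c1] touch_A[OF c(2)] by blast
  obtain b1 b2 where b: "b1 \<in> B" "adj b1 c1" "b2 \<in> B" "adj b2 c2"
    using touch_B[OF c1] touch_B[OF c(2)] by blast
  have inV: "a1 \<in> V" "a2 \<in> V" "b1 \<in> V" "b2 \<in> V" "c1 \<in> V" "c2 \<in> V"
    using a b c T sub by blast+
  obtain p where p: "chain1 adj p" "\<And>x y. p x y \<noteq> 0 \<Longrightarrow> x \<in> A \<and> y \<in> A"
    "\<And>y. (\<Sum>t\<in>V. p t y) = (of_bool (y = a1) - of_bool (y = a2) :: 'f)"
    using path_chain[OF finite_V adj_V_sym connected_A a(3,1)] by blast
  obtain q where q: "chain1 adj q" "\<And>x y. q x y \<noteq> 0 \<Longrightarrow> x \<in> B \<and> y \<in> B"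
    "\<And>y. (\<Sum>t\<in>V. q t y) = (of_bool (y = b2) - of_bool (y = b1) :: 'f)"
    using path_chain[OF finite_V adj_V_sym connected_B b(1,3)] by blast
  \<comment> \<open>The loop runs through \<open>A\<close> from \<open>a2\<close> to
    \<open>a1\<close>, across \<open>c1\<close> to \<open>b1\<close>, through \<open>B\<close> to
    \<open>b2\<close>, and back across \<open>c2\<close>.\<close>
  define k where "k x y = p x y + (edge_chain a1 c1 x y + (edge_chain c1 b1 x y +
    (q x y + (edge_chain b2 c2 x y + edge_chain c2 a2 x y))))" for x y
  have k1: "chain1 adj k"
    unfolding k_def
    by (intro chain1_add p q chain1_edge_chain a b adj_sym[OF a(2)] adj_sym[OF b(4)] adj_sym[OF a(4)] adj_sym[OF b(2)])
  have k2: "(\<Sum>t\<in>V. k t y) = 0" for y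
    unfolding k_def by (simp add: sum.distrib p(3) q(3) sum_edge_chain[OF finite_V] inV)
  obtain e where e: "chain2 adj e" "\<And>x y. (\<Sum>t\<in>V. e t x y) = k x y"
    using H1_vanishes[OF k1 k2] by blast
  have TV: "T \<subseteq> V" using T sub by blast
  have fin: "finite A" "finite T" using finite_subset[OF _ finite_V] sub(1) TV by blast+
  have diag: "e t x t = 0" "e t t x = 0" for t x
    using chain2_support[OF e(1), of t x t] chain2_support[OF e(1), of t t x] adj_irrefl by blast+
  \<comment> \<open>The third vertex of a triangle on such an edge is a neighbour of
    \<open>x\<close>, hence in \<open>A\<close> or \<open>C\<close>, and a neighbour of
    \<open>y\<close>, hence not in \<open>C - T\<close>.\<close>
  have split: "(\<Sum>t\<in>V. e t x y) = (\<Sum>t\<in>A. e t x y) + (\<Sum>t\<in>T. e t x y)" if "x \<in> A" "y \<in> T" for x y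
  proof -
    have "(\<Sum>t\<in>A. e t x y) + (\<Sum>t\<in>T. e t x y) = (\<Sum>t\<in>A \<union> T. e t x y)"
      by (rule sum.union_disjoint[symmetric]) (use fin T disj in auto)
    also have "\<dots> = (\<Sum>t\<in>V. e t x y)"
    proof (rule sum.mono_neutral_left)
      show "\<forall>i\<in>V - (A \<union> T). e i x y = 0"
      proof (intro ballI, rule ccontr)
        fix i assume i: "i \<in> V - (A \<union> T)" "e i x y \<noteq> 0"
        then have "adj x i" "adj y i" using chain2_support[OF e(1)] adj_sym by blast+
        then show False using closed_A[of x i] that i no by blast
      qed
    qed (use finite_V sub T in auto)
    finally show ?thesis by simp
  qed
  have "(\<Sum>y\<in>T. \<Sum>x\<in>A. k x y) = (\<Sum>y\<in>T. \<Sum>x\<in>A. (\<Sum>t\<in>A. e t x y) + (\<Sum>t\<in>T. e t x y))"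
    by (intro sum.cong refl) (simp add: split flip: e(2))
  also have "\<dots> = (\<Sum>y\<in>T. \<Sum>x\<in>A. \<Sum>t\<in>A. e t x y) + (\<Sum>y\<in>T. \<Sum>x\<in>A. \<Sum>t\<in>T. e t x y)"
    by (simp add: sum.distrib)
  also have "(\<Sum>y\<in>T. \<Sum>x\<in>A. \<Sum>t\<in>A. e t x y) = 0"
  proof (rule sum.neutral, rule ballI)
    fix y assume "y \<in> T"
    show "(\<Sum>x\<in>A. \<Sum>t\<in>A. e t x y) = 0"
      by (rule sum_antisymmetric_zero[OF fin(1)]) (rule chain2_swap(1)[OF e(1)], rule diag)
  qed
  also have "(\<Sum>y\<in>T. \<Sum>x\<in>A. \<Sum>t\<in>T. e t x y) = (\<Sum>x\<in>A. \<Sum>y\<in>T. \<Sum>t\<in>T. e t x y)"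
    by (rule sum.swap)
  also have "\<dots> = 0"
  proof (rule sum.neutral, rule ballI)
    fix x assume "x \<in> A"
    show "(\<Sum>y\<in>T. \<Sum>t\<in>T. e t x y) = 0"
      by (rule sum_antisymmetric_zero[OF fin(2)]) (rule chain2_swap(3)[OF e(1)], rule diag)
  qed
  finally have "(\<Sum>y\<in>T. \<Sum>x\<in>A. k x y) = 0" by simp
  moreover have "(\<Sum>y\<in>T. \<Sum>x\<in>A. k x y) = (\<Sum>y\<in>T. \<Sum>x\<in>A. of_bool (y = c1 \<and> x = a1))"
  proof (intro sum.cong refl)
    fix x y assume xy: "x \<in> A" "y \<in> T"
    have "p x y = 0" "q x y = 0" using p(2)[of x y] q(2)[of x y] xy T disj by blast+
    moreover have "x \<noteq> c1" "x \<noteq> b1" "x \<noteq> b2" "x \<noteq> c2" "y \<noteq> c2" "y \<noteq> a1" "y \<noteq> a2"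
      using xy T c a b disj by blast+
    ultimately show "k x y = of_bool (y = c1 \<and> x = a1)"
      unfolding k_def edge_chain_def by (simp add: conj_commute)
  qed
  moreover have "\<dots> = (\<Sum>y\<in>T. of_bool (y = c1))"
    by (intro sum.cong refl) (use fin a in \<open>simp add: of_bool_def\<close>)
  moreover have "(\<Sum>y\<in>T. of_bool (y = c1)) = (1 :: 'f)"
    using fin c by (simp add: of_bool_def)
  ultimately show False by simp
qed

end

section \<open>Graphs without far edges\<close>

context surface_graph
begin

text \<open>\<open>S\<close> is the complement of the closed stars of \<open>v\<close> and
  \<open>x\<close>. A vertex adjacent to the component \<open>B\<close> of \<open>S\<close> but not
  in it belongs to one of these stars, so it is a neighbour of \<open>v\<close> or \<open>x\<close>.
  Thus every vertex of \<open>C\<close> touches both sides, and no minimisation is required.\<close>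

lemma separation_of_far_edges:
  assumes vx: "adj v x" and uw: "adj u w"
    and far: "\<not> adj v u" "v \<noteq> u" "\<not> adj x u" "x \<noteq> u" "\<not> adj v w" "v \<noteq> w" "\<not> adj x w" "x \<noteq> w"
  obtains A B C where "separation V adj Z A B C" "v \<in> A" "x \<in> A" "u \<in> B" "w \<in> B"
proof -
  define S where "S = V - ({v, x} \<union> lk v \<union> lk x)"
  define B where "B = component adj S u"
  define C where "C = {y\<in>V - B. \<exists>b\<in>B. adj b y}"
  define A where "A = component adj (V - C) v"
  have V: "v \<in> V" "x \<in> V" "u \<in> V" "w \<in> V" using adj_V adj_sym vx uw by blast+
  have uS: "u \<in> S" "w \<in> S" using V far unfolding S_def by (auto simp: in_lk)
  have BS: "B \<subseteq> S" unfolding B_def by (rule component_subset)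
  have B_closed: "y \<in> B" if "b \<in> B" "y \<in> S" "adj b y" for b y
    unfolding B_def by (rule component_closed[OF adj_sym uS(1) that[unfolded B_def]])
  have uB: "u \<in> B" unfolding B_def by (rule component_self[OF uS(1)])
  have wB: "w \<in> B" using B_closed[OF uB uS(2) uw] .
  have C_sub: "y \<in> lk v \<union> lk x" "y \<noteq> v" "y \<noteq> x" if "y \<in> C" for y
  proof -
    obtain b where b: "b \<in> B" "adj b y" "y \<in> V" "y \<notin> B" using \<open>y \<in> C\<close> unfolding C_def by blast
    have "y \<notin> S" using B_closed b by blast
    moreover have "\<not> adj b v" "\<not> adj b x" using b(1) BS adj_sym in_lk unfolding S_def by blast+
    then show "y \<noteq> v" "y \<noteq> x" using b(2) by blast+
    ultimately show "y \<in> lk v \<union> lk x" using b(3) unfolding S_def by blast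
  qed
  have vC: "v \<in> V - C" "x \<in> V - C" using C_sub V by blast+
  have A_sub: "A \<subseteq> V - C" unfolding A_def by (rule component_subset)
  have A_closed: "y \<in> A" if "a \<in> A" "y \<in> V - C" "adj a y" for a y
    unfolding A_def by (rule component_closed[OF adj_sym vC(1) that[unfolded A_def]])
  have vA: "v \<in> A" unfolding A_def by (rule component_self[OF vC(1)])
  have xA: "x \<in> A" using A_closed[OF vA vC(2) vx] .
  have A_conn: "cut_connected adj A" unfolding A_def by (rule component_connected[OF adj_sym])
  have B_conn: "cut_connected adj B" unfolding B_def by (rule component_connected[OF adj_sym])
  have clB: "y \<in> B \<union> C" if "b \<in> B" "adj b y" for b y
    using that adj_V adj_sym unfolding C_def by blast
  have AB: "A \<inter> B = {}"
  proof (rule ccontr)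
    assume "A \<inter> B \<noteq> {}"
    then obtain t where t: "t \<in> A" "t \<in> B" by blast
    have "v \<in> B"
      by (rule cut_connected_propagate[OF A_conn t(1), of "\<lambda>y. y \<in> B"])
         (use t vA clB A_sub in blast)+
    then show False using BS unfolding S_def by blast
  qed
  have "separation V adj Z A B C"
  proof unfold_locales
    show "A \<subseteq> V" "B \<subseteq> V" "C \<subseteq> V" using A_sub BS unfolding S_def C_def by blast+
    show "A \<inter> B = {}" by (rule AB)
    show "A \<inter> C = {}" using A_sub by blast
    show "B \<inter> C = {}" unfolding C_def by blast
    show "A \<noteq> {}" "B \<noteq> {}" using vA uB by blast+
    show "cut_connected adj A" "cut_connected adj B" by (rule A_conn B_conn)+
    show "y \<in> A \<union> C" if "a \<in> A" "adj a y" for a y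
      using A_closed that adj_V[OF adj_sym[OF that(2)]] by blast
    show "y \<in> B \<union> C" if "a \<in> B" "adj a y" for a y using clB that .
    show "\<exists>a\<in>A. adj a c" if "c \<in> C" for c
      using C_sub(1)[OF that] vA xA in_lk by blast
    show "\<exists>a\<in>B. adj a c" if "c \<in> C" for c using that unfolding C_def by blast
  qed
  then show thesis using that vA xA uB wB by blast
qed

text \<open>Summing \<open>\<partial>Z = 0\<close> over the edges from \<open>y\<close> to \<open>K\<close> leaves the single term \<open>Z q y p\<close>.\<close>

lemma no_bridge_in_lk:
  assumes y: "y \<in> V" and K: "K \<subseteq> lk y" and pq: "p \<in> K" "q \<in> lk y - K" "adj p q"
    and unique: "\<And>p' q'. p' \<in> K \<Longrightarrow> q' \<in> lk y - K \<Longrightarrow> adj p' q' \<Longrightarrow> p' = p \<and> q' = q"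
  shows False
proof -
  have KV: "K \<subseteq> V" using K lk_V by blast
  have fin: "finite K" "finite (V - K)" using finite_subset[OF KV finite_V] finite_V by blast+
  have split: "(\<Sum>t\<in>K. Z t y s) + (\<Sum>t\<in>V - K. Z t y s) = 0" for s
    using sum.subset_diff[OF KV finite_V, of "\<lambda>t. Z t y s"] cycle_Z[of y s] by (simp add: add.commute)
  have "(\<Sum>s\<in>K. \<Sum>t\<in>K. Z t y s) = 0"
  proof (rule sum_antisymmetric_zero[OF fin(1)])
    show "Z t y s = - Z s y t" for s t by (rule chain2_swap(3)[OF chain2_Z])
    show "Z s y s = 0" for s using chain2_support[OF chain2_Z, of s y s] adj_irrefl by blast
  qed
  then have "(\<Sum>s\<in>K. \<Sum>t\<in>V - K. Z t y s) = (\<Sum>s\<in>K. (\<Sum>t\<in>K. Z t y s) + (\<Sum>t\<in>V - K. Z t y s))"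
    by (simp add: sum.distrib)
  also have "\<dots> = 0" using split by simp
  finally have zero: "(\<Sum>s\<in>K. \<Sum>t\<in>V - K. Z t y s) = 0" .
  have only: "s = p \<and> t = q" if "s \<in> K" "t \<in> V - K" "Z t y s \<noteq> 0" for s t
  proof -
    have "adj t y" "adj t s" using chain2_support[OF chain2_Z that(3)] by blast+
    then have "t \<in> lk y - K" "adj s t" using that(2) adj_sym in_lk by blast+
    then show ?thesis using unique[OF that(1)] by blast
  qed
  have "(\<Sum>s\<in>K. \<Sum>t\<in>V - K. Z t y s) = (\<Sum>s\<in>{p}. \<Sum>t\<in>V - K. Z t y s)"
  proof (rule sum.mono_neutral_right[OF fin(1)])
    show "\<forall>s\<in>K - {p}. (\<Sum>t\<in>V - K. Z t y s) = 0"
      using only by (intro ballI sum.neutral) blast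
  qed (use pq in blast)
  also have "\<dots> = (\<Sum>t\<in>V - K. Z t y p)" by simp
  also have "\<dots> = (\<Sum>t\<in>{q}. Z t y p)"
  proof (rule sum.mono_neutral_right[OF fin(2)])
    show "{q} \<subseteq> V - K" using pq lk_V by blast
    show "\<forall>t\<in>V - K - {q}. Z t y p = 0" using only[OF pq(1)] by blast
  qed
  also have "\<dots> = Z q y p" by simp
  finally have "Z q y p = 0" using zero by simp
  moreover have "adj y p" "adj y q" using K pq in_lk by blast+
  ultimately show False using Z_triangle_nonzero[of q y p] adj_sym pq(3) by blast
qed

text \<open>For a neighbour \<open>y\<close> of \<open>v\<close>, the link of \<open>y\<close>
  consists of \<open>v\<close>, its two neighbours there, and vertices of \<open>?R\<close>; the
  absence of bridges confines the latter to one of \<open>T\<close> and \<open>?R - T\<close>.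
  Adjacent neighbours of \<open>v\<close> have a common neighbour in \<open>?R\<close>, so this part
  is the same all along the link of \<open>v\<close>, whereas connectedness of \<open>V\<close>
  requires both parts to be met.\<close>

lemma connected_complement_of_star:
  assumes v: "v \<in> V"
  shows "cut_connected adj (V - insert v (lk v))" (is "cut_connected adj ?R")
  unfolding cut_connected_def
proof (intro allI impI, rule ccontr)
  fix T assume T: "T \<subseteq> ?R" "T \<noteq> {}" "T \<noteq> ?R" and no: "\<not> (\<exists>a\<in>T. \<exists>b\<in>?R - T. adj a b)"
  have one_side: "lk y \<inter> T = {} \<or> lk y \<inter> (?R - T) = {}" if y: "y \<in> lk v" for y
  proof (rule ccontr)
    assume both: "\<not> ?thesis"
    have vy: "adj v y" "adj y v" using y adj_sym in_lk by blast+
    have yV: "y \<in> V" using vy adj_V by blast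
    obtain y1 y2 where y12: "y1 \<noteq> y2" "\<And>t. adj v t \<and> adj y t \<longleftrightarrow> t = y1 \<or> t = y2"
      using edge_link[OF vy(1)] by blast
    then have yy: "adj v y1" "adj y y1" "adj v y2" "adj y y2" by blast+
    obtain r1 where r1: "\<And>r. adj y r \<Longrightarrow> adj y1 r \<Longrightarrow> r = v \<or> r = r1"
      using other_common_neighbour[OF yy(2) vy(2) adj_sym[OF yy(1)]] by metis
    obtain r2 where r2: "\<And>r. adj y r \<Longrightarrow> adj y2 r \<Longrightarrow> r = v \<or> r = r2"
      using other_common_neighbour[OF yy(4) vy(2) adj_sym[OF yy(3)]] by metis
    \<comment> \<open>Along the link of \<open>y\<close>, \<open>r1\<close> and \<open>r2\<close>
      come after \<open>y1\<close> and \<open>y2\<close> as seen from \<open>v\<close>; the edges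
      \<open>r1 y1\<close> and \<open>r2 y2\<close> are the only ones by which a part
      \<open>K\<close> can be left.\<close>
    have out: "(p = r1 \<and> q = y1) \<or> (p = r2 \<and> q = y2)"
      if K: "K = T \<or> K = ?R - T" and pq: "p \<in> lk y \<inter> K" "q \<in> lk y - lk y \<inter> K" "adj p q" for K p q
    proof -
      have pR: "p \<in> ?R" using pq K T by blast
      have "q \<notin> ?R" using pq K T no adj_sym by blast
      moreover have "q \<noteq> v" using pR pq(3) adj_sym in_lk by blast
      ultimately have "adj v q" using pq(2) lk_V in_lk by blast
      then have "q = y1 \<or> q = y2" using y12(2) pq(2) in_lk by blast
      moreover have "p \<noteq> v" using pR by blast
      ultimately show ?thesis using r1[of p] r2[of p] pq(1,3) adj_sym in_lk by blast
    qed
    \<comment> \<open>If \<open>r1\<close> were not in \<open>K\<close>, a single edge would leave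
      \<open>K\<close> in the link, a bridge. So \<open>r1\<close> would have to lie in both
      parts.\<close>
    have both_out: "r1 \<in> K" if K: "K = T \<or> K = ?R - T" for K
    proof (rule ccontr)
      assume r1K: "r1 \<notin> K"
      have "lk y \<inter> K \<noteq> {}" "lk y \<inter> K \<subseteq> lk y" using both K by blast+
      moreover have "lk y \<inter> K \<noteq> lk y" using vy K T in_lk by blast
      ultimately obtain p q where pq: "p \<in> lk y \<inter> K" "q \<in> lk y" "q \<notin> lk y \<inter> K" "adj p q"
        by (metis cut_connectedD[OF connected_lk[OF yV]])
      show False
      proof (rule no_bridge_in_lk[OF yV, of "lk y \<inter> K" p q])
        fix p' q' assume "p' \<in> lk y \<inter> K" "q' \<in> lk y - lk y \<inter> K" "adj p' q'"
        then show "p' = p \<and> q' = q" using out[OF K, of p' q'] out[OF K, of p q] pq r1K by blast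
      qed (use pq in blast)+
    qed
    show False using both_out[of T] both_out[of "?R - T"] by blast
  qed
  have shared: "\<exists>t. t \<in> ?R \<and> adj y t \<and> adj z t" if yz: "y \<in> lk v" "z \<in> lk v" "adj y z" for y z
  proof -
    have a: "adj v y" "adj v z" "adj y v" "adj z v" using yz adj_sym in_lk by blast+
    obtain t where t: "t \<noteq> v" "adj y t" "adj z t" "\<not> adj t v"
      using other_common_neighbour[OF yz(3) a(3,4)] by metis
    then have "t \<in> V" "t \<notin> lk v" using adj_V adj_sym in_lk by blast+
    then show ?thesis using t by blast
  qed
  have reach: "\<exists>y\<in>lk v. lk y \<inter> K \<noteq> {}" if K: "K = T \<or> K = ?R - T" for K
  proof -
    have "K \<subseteq> V" "K \<noteq> {}" "K \<noteq> V" using K T v by blast+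
    then obtain p y where p: "p \<in> K" "y \<in> V" "y \<notin> K" "adj p y"
      by (metis cut_connectedD[OF connected_V])
    have "y \<notin> ?R" using p K T no adj_sym by blast
    moreover have "y \<noteq> v" using p K T adj_sym in_lk by blast
    ultimately have "y \<in> lk v" using p(2) by blast
    moreover have "p \<in> lk y" using p adj_sym in_lk by blast
    ultimately show ?thesis using p(1) by blast
  qed
  obtain y where y: "y \<in> lk v" "lk y \<inter> T \<noteq> {}" using reach[of T] by blast
  obtain z where z: "z \<in> lk v" "lk z \<inter> (?R - T) \<noteq> {}" using reach[of "?R - T"] by blast
  have "lk z \<inter> (?R - T) = {}"
  proof (rule cut_connected_propagate[OF connected_lk[OF v] y(1), of "\<lambda>y. lk y \<inter> (?R - T) = {}"])
    show "lk y \<inter> (?R - T) = {}" using one_side y by blast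
    fix a b assume ab: "a \<in> lk v" "b \<in> lk v" "lk a \<inter> (?R - T) = {}" "adj a b"
    obtain t where t: "t \<in> ?R" "adj a t" "adj b t" using shared[OF ab(1,2,4)] by blast
    then have "t \<in> lk a" "t \<in> lk b" using in_lk by blast+
    then show "lk b \<inter> (?R - T) = {}" using one_side[OF ab(2)] t(1) ab(3) by blast
  qed (rule z)
  then show False using z by blast
qed

text \<open>The ends of the path \<open>y0 y1 y2\<close> in the link are not adjacent, so the second
  neighbour \<open>y3\<close> of \<open>y2\<close> in the link is a fourth vertex.\<close>

lemma card_lk_ge_4:
  assumes v: "v \<in> V"
  shows "4 \<le> card (lk v)"
proof -
  obtain y1 where y1: "adj v y1" using link_nonempty[OF v] by blast
  obtain y0 y2 where y: "y0 \<noteq> y2" "\<not> adj y0 y2" "adj v y0" "adj y1 y0" "adj v y2" "adj y1 y2"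
    using edge_link[OF y1] by metis
  obtain y3 where y3: "y3 \<noteq> y1" "adj v y3" "adj y2 y3" "\<not> adj y3 y1"
    using other_common_neighbour[OF y(5) y1 adj_sym[OF y(6)]] by metis
  have ne: "y0 \<noteq> y1" "y2 \<noteq> y1" "y0 \<noteq> y3" "y2 \<noteq> y3"
    using y y3 adj_irrefl adj_sym by blast+
  have "card {y0, y1, y2, y3} = 4" using ne y y3 by simp
  moreover have "{y0, y1, y2, y3} \<subseteq> lk v" using y y1 y3 in_lk by blast
  ultimately show ?thesis using card_mono[of "lk v"] finite_subset[OF lk_V finite_V] by metis
qed

end

section \<open>Spheres in which no edge is far from an edge at \<open>v\<close>\<close>

locale no_far_edges = surface_graph V adj Z
  for V :: "'a set" and adj and Z :: "'a \<Rightarrow> 'a \<Rightarrow> 'a \<Rightarrow> 'f::field" +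
  fixes v :: 'a
  assumes v_V: "v \<in> V"
    and dominating: "\<lbrakk>adj v x; adj u w; \<not> adj v u; v \<noteq> u; \<not> adj v w; v \<noteq> w\<rbrakk> \<Longrightarrow> adj x u \<or> adj x w"
begin

definition R :: "'a set" where "R = V - insert v (lk v)"

lemma in_R: "u \<in> R \<longleftrightarrow> u \<in> V \<and> u \<noteq> v \<and> \<not> adj v u"
  unfolding R_def by (auto simp: in_lk)

lemma dominating_R: "x \<in> lk v \<Longrightarrow> u \<in> R \<Longrightarrow> w \<in> R \<Longrightarrow> adj u w \<Longrightarrow> adj x u \<or> adj x w"
  using dominating in_R in_lk by metis

text \<open>Otherwise duality for \<open>{a, b, u}\<close> and the rest of the link of \<open>v\<close>, joined to \<open>{w, z}\<close>,
  makes \<open>a\<close> and \<open>b\<close> adjacent, and this edge has three common neighbours \<open>v\<close>, \<open>u\<close>, \<open>z\<close>.\<close>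

lemma at_most_one_missed:
  assumes R: "w \<in> R" "u \<in> R" "z \<in> R" "u \<noteq> z" and wu: "adj w u" and wz: "adj w z"
    and a: "a \<in> lk v" "\<not> adj w a" and b: "b \<in> lk v" "\<not> adj w b"
  shows "a = b"
proof (rule ccontr)
  assume "a \<noteq> b"
  have nw: "\<not> adj a w" "\<not> adj b w" using a b adj_sym by blast+
  have au: "adj a u" "adj a z" "adj b u" "adj b z"
    using dominating_R[OF a(1) R(1,2) wu] dominating_R[OF a(1) R(1,3) wz]
      dominating_R[OF b(1) R(1,2) wu] dominating_R[OF b(1) R(1,3) wz] nw by blast+
  let ?D = "{b, a, u}" and ?W = "{w, z} \<union> (lk v - {a, b})"
  have notL: "w \<notin> lk v" "u \<notin> lk v" "z \<notin> lk v" "w \<noteq> v" "u \<noteq> v" "z \<noteq> v" "v \<notin> lk v" "w \<noteq> u"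
    using R wu adj_irrefl in_R in_lk by blast+
  have D: "cut_connected adj ?D"
    by (rule cut_connected_insert[OF cut_connected_pair[of adj a u, OF au(1) adj_sym[OF au(1)]], of u])
       (use au adj_sym in blast)+
  have W: "cut_connected adj ?W"
  proof (rule cut_connected_attach[OF cut_connected_pair[of adj w z, OF wz adj_sym[OF wz]]])
    fix x assume "x \<in> lk v - {a, b}"
    then show "\<exists>a\<in>{w, z}. adj a x" using dominating_R[OF _ R(1,3) wz, of x] adj_sym by blast
  qed (use adj_sym in blast)+
  have "?D \<subseteq> V - {v}" "lk v \<inter> ?D \<noteq> {}" "?W \<subseteq> V - {v}" "?W \<noteq> {}" "?D \<inter> ?W = {}"
    using a b R notL lk_V in_R by blast+
  then obtain D' where D': "?D \<subseteq> D'" "D' \<inter> ?W = {}" "cut_connected adj (lk v \<inter> D')"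
    using enlarge_connected_trace[OF v_V D _ _ W] by metis
  have "lk v \<inter> D' = {a, b}" using D' a b by blast
  then have "cut_connected adj {a, b}" using D'(3) by simp
  then obtain s t where "s \<in> {a}" "t \<in> {a, b}" "t \<notin> {a}" "adj s t"
    by (rule cut_connectedD[of _ _ "{a}"]) (use \<open>a \<noteq> b\<close> in blast)+
  then have "adj a b" by blast
  moreover have "adj a v" "adj b v" using a b adj_sym in_lk by blast+
  ultimately have "u = z \<or> u = v \<or> z = v"
    using three_common_neighbours[of a b u z v] au by blast
  then show False using R(4) notL by blast
qed

text \<open>A path \<open>w\<close>, \<open>t\<close>, \<open>s\<close> in \<open>R\<close> with \<open>s\<close> not adjacent to \<open>w\<close> would force the link of \<open>v\<close> to be a
  4-cycle \<open>p a q b\<close> and the link of \<open>t\<close> to be the 4-cycle \<open>w p a q\<close>, which does not contain \<open>s\<close>.\<close>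

lemma R_subset_lk:
  assumes R: "w \<in> R" "u \<in> R" "z \<in> R" "u \<noteq> z" and wu: "adj w u" and wz: "adj w z"
  shows "R - {w} \<subseteq> lk w"
proof (rule ccontr)
  assume far: "\<not> ?thesis"
  let ?T = "insert w (lk w \<inter> R)"
  have "?T \<subseteq> R" "?T \<noteq> {}" "?T \<noteq> R" using R far by blast+
  then obtain t s where ts: "t \<in> ?T" "s \<in> R" "s \<notin> ?T" "adj t s"
    using cut_connectedD[OF connected_complement_of_star[OF v_V, folded R_def]] by metis
  have sw: "s \<noteq> w" "\<not> adj w s" using ts in_lk by blast+
  then have "t \<noteq> w" using ts(4) by blast
  then have t: "t \<in> R" "adj w t" "adj t w" using ts(1) adj_sym in_lk by blast+
  obtain p q where pq: "p \<noteq> q" "\<not> adj p q" and pq_iff: "\<And>r. adj w r \<and> adj t r \<longleftrightarrow> r = p \<or> r = q"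
    using edge_link[OF t(2)] by blast
  have pq_adj: "adj w p" "adj t p" "adj w q" "adj t q" using pq_iff by blast+
  \<comment> \<open>A neighbour of \<open>v\<close> missed by neither \<open>w\<close> nor
    \<open>t\<close> is a common neighbour of both, hence \<open>p\<close> or \<open>q\<close>. The
    bound on missed neighbours applies to \<open>t\<close> as well, through its neighbours
    \<open>w\<close> and \<open>s\<close> in \<open>R\<close>. As the link of \<open>v\<close> has
    at least four elements, \<open>p\<close> and \<open>q\<close> both lie in it, and
    \<open>M\<close> and \<open>N\<close> are singletons.\<close>
  define M where "M = {a\<in>lk v. \<not> adj w a}"
  define N where "N = {a\<in>lk v. \<not> adj t a}"
  have finL: "finite (lk v)" by (rule finite_subset[OF lk_V finite_V])
  have finMN: "finite M" "finite N" unfolding M_def N_def using finL by simp_all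
  have M1: "a = b" if "a \<in> M" "b \<in> M" for a b
    using at_most_one_missed[OF R wu wz] that unfolding M_def by blast
  have N1: "a = b" if "a \<in> N" "b \<in> N" for a b
    using at_most_one_missed[OF t(1) R(1) ts(2) sw(1)[symmetric] t(3) ts(4)] that unfolding N_def by blast
  have L_sub: "lk v \<subseteq> (lk v \<inter> {p, q}) \<union> M \<union> N" unfolding M_def N_def using pq_iff by blast
  have cM: "card M \<le> 1" "card N \<le> 1" using M1 N1 finMN by (simp_all add: card_le_Suc0_iff_eq)
  have "card (lk v) \<le> card ((lk v \<inter> {p, q}) \<union> M \<union> N)"
    by (rule card_mono[OF _ L_sub]) (use finMN in simp)
  also have "\<dots> \<le> card (lk v \<inter> {p, q}) + card M + card N"
    by (meson add_le_mono1 card_Un_le order_trans)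
  finally have "4 \<le> card (lk v \<inter> {p, q}) + card M + card N" using card_lk_ge_4[OF v_V] by linarith
  moreover have "card (lk v \<inter> {p, q}) \<le> card {p, q}" by (rule card_mono) auto
  moreover have "card {p, q} = 2" using pq by simp
  ultimately have c: "card (lk v \<inter> {p, q}) = card {p, q}" "card M \<noteq> 0" "card N \<noteq> 0" using cM by linarith+
  have "lk v \<inter> {p, q} = {p, q}" by (rule card_subset_eq) (use c in auto)
  then have pqL: "p \<in> lk v" "q \<in> lk v" by blast+
  obtain a where a: "a \<in> M" using c(2) by fastforce
  obtain b where b: "b \<in> N" using c(3) by fastforce
  have L: "x = p \<or> x = q \<or> x = a \<or> x = b" if "x \<in> lk v" for x using L_sub that M1 N1 a b by blast
  have aL: "a \<in> lk v" "adj t a" "\<not> adj w a"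
    using a dominating_R[OF _ R(1) t(1,2), of a] adj_sym unfolding M_def by blast+
  \<comment> \<open>Two of the at most four elements of the link of \<open>v\<close> are excluded,
    and \<open>x\<close> has two neighbours in it, which must be \<open>a\<close> and
    \<open>b\<close>.\<close>
  have adj_a: "adj x a" if x: "x \<in> lk v" "\<not> adj x p" "\<not> adj x q" for x
  proof -
    have vx: "adj v x" using x in_lk by blast
    obtain r1 r2 where r: "r1 \<noteq> r2" "adj v r1" "adj x r1" "adj v r2" "adj x r2"
      using edge_link[OF vx] by metis
    then have "r1 \<in> {a, b}" "r2 \<in> {a, b}" using L[of r1] L[of r2] x in_lk by blast+
    then show ?thesis using r by blast
  qed
  have pa: "adj p a" "adj q a" using adj_a pqL pq(2) adj_irrefl adj_sym by blast+
  let ?S = "{w, p, q, a}"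
  have a_ne: "a \<noteq> w" using aL(1) R(1) in_R in_lk by blast
  \<comment> \<open>Each vertex of \<open>?S\<close> already has its two neighbours of the link of
    \<open>t\<close> inside \<open>?S\<close>.\<close>
  have closed: "y \<in> ?S" if xy: "x \<in> ?S" "adj t y" "adj x y" for x y
  proof -
    consider "x = w" | "x = p" | "x = q" | "x = a" using xy by blast
    then show ?thesis
    proof cases
      case 1
      then show ?thesis using pq_iff xy by blast
    next
      case 2
      have "a = w \<or> a = y \<or> w = y"
        by (rule three_common_neighbours[of t p]) (use 2 xy aL pa t pq_adj adj_sym in blast)+
      then show ?thesis using a_ne by blast
    next
      case 3
      have "a = w \<or> a = y \<or> w = y"
        by (rule three_common_neighbours[of t q]) (use 3 xy aL pa t pq_adj adj_sym in blast)+
      then show ?thesis using a_ne by blast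
    next
      case 4
      have "p = q \<or> p = y \<or> q = y"
        by (rule three_common_neighbours[of t a]) (use 4 xy aL pa t pq_adj adj_sym in blast)+
      then show ?thesis using pq by blast
    qed
  qed
  have tV: "t \<in> V" using t adj_V by blast
  have "s \<in> ?S"
    by (rule cut_connected_propagate[OF connected_lk[OF tV], of w "\<lambda>x. x \<in> ?S"])
       (use t ts closed in_lk in blast)+
  then show False using sw(1) ts(2) pqL aL(1) in_R in_lk by blast
qed

text \<open>The bound 2 consists of \<open>v\<close> itself and the at most one neighbour of
  \<open>v\<close> that \<open>w\<close> misses.\<close>

lemma few_non_neighbours:
  assumes "2 < card {w\<in>V. w \<noteq> v \<and> \<not> adj v w}"
  shows "\<exists>w\<in>V. card {y\<in>V. y \<noteq> w \<and> \<not> adj w y} \<le> 2"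
proof -
  have "R = {w\<in>V. w \<noteq> v \<and> \<not> adj v w}" using in_R by blast
  then have cR: "2 < card R" using assms by simp
  have conn: "cut_connected adj R" unfolding R_def by (rule connected_complement_of_star[OF v_V])
  have big: "R \<noteq> {}" "R \<noteq> {r}" "R \<noteq> {r, s}" for r s
    using cR by (auto simp: card_insert_if split: if_splits)
  obtain r where r: "r \<in> R" using big by blast
  obtain s where s: "s \<in> R" "s \<noteq> r" "adj r s"
    by (rule cut_connectedD[OF conn, of "{r}"]) (use r big(2)[of r] in blast)+
  obtain x t where xt: "x \<in> {r, s}" "t \<in> R" "t \<notin> {r, s}" "adj x t"
    by (rule cut_connectedD[OF conn, of "{r, s}"]) (use r s big(3)[of r s] in blast)+
  \<comment> \<open>The middle vertex \<open>w\<close> is the end of the edge \<open>r s\<close>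
    from which the third vertex \<open>t\<close> is reached.\<close>
  obtain w u z where w: "w \<in> R" "u \<in> R" "z \<in> R" "u \<noteq> z" "adj w u" "adj w z"
  proof (cases "x = r")
    case True
    show ?thesis by (rule that[of r s t]) (use True r s xt in auto)
  next
    case False
    then have "x = s" using xt by blast
    show ?thesis by (rule that[of s r t]) (use \<open>x = s\<close> r s(1) adj_sym[OF s(3)] xt in auto)
  qed
  let ?M = "{a\<in>lk v. \<not> adj w a}"
  have finM: "finite ?M" using finite_subset[OF lk_V finite_V] by simp
  have "{y\<in>V. y \<noteq> w \<and> \<not> adj w y} \<subseteq> insert v ?M"
  proof
    fix y assume "y \<in> {y\<in>V. y \<noteq> w \<and> \<not> adj w y}"
    then have y: "y \<in> V" "y \<noteq> w" "\<not> adj w y" by blast+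
    then have "y \<notin> R" using R_subset_lk[OF w] in_lk by blast
    then show "y \<in> insert v ?M" using y in_R in_lk by blast
  qed
  then have "card {y\<in>V. y \<noteq> w \<and> \<not> adj w y} \<le> card (insert v ?M)"
    by (rule card_mono[rotated]) (use finM in simp)
  also have "\<dots> \<le> Suc (card ?M)" by (rule card_insert_le_m1) simp_all
  also have "card ?M \<le> 1"
    using at_most_one_missed[OF w] finM by (auto simp: card_le_Suc0_iff_eq)
  finally have "card {y\<in>V. y \<noteq> w \<and> \<not> adj w y} \<le> 2" by simp
  then show ?thesis using w(1) in_R by blast
qed

end

context surface_graph
begin

theorem separating_cycle_or_few_non_neighbours:
  assumes v: "v \<in> V" and many: "\<And>u. u \<in> V \<Longrightarrow> 2 < card {w\<in>V. w \<noteq> u \<and> \<not> adj u w}"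
  obtains A B C where "separation V adj Z A B C" "v \<in> A" "\<And>t. A \<noteq> {t}" "\<And>t. B \<noteq> {t}"
proof -
  obtain x u w where far: "adj v x" "adj u w" "\<not> adj v u" "v \<noteq> u" "\<not> adj v w" "v \<noteq> w"
    "\<not> adj x u" "\<not> adj x w"
  proof (rule ccontr)
    assume "\<not> thesis"
    then interpret no_far_edges V adj Z v
      using that v by unfold_locales blast+
    \<comment> \<open>\<open>many\<close> enters twice: at \<open>v\<close> it makes
      \<open>R\<close> large, and at the vertex produced it gives the contradiction.\<close>
    show False using few_non_neighbours many v by fastforce
  qed
  then have "x \<noteq> u" "x \<noteq> w" by blast+
  then obtain A B C where "separation V adj Z A B C" "v \<in> A" "x \<in> A" "u \<in> B" "w \<in> B"
    using separation_of_far_edges[of v x u w] far by metis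
  moreover have "v \<noteq> x" "u \<noteq> w" using far adj_irrefl by blast+
  ultimately show thesis using that by blast
qed

end

section \<open>Oriented simplicial homology in low degrees\<close>

context separation
begin

text \<open>Subtracting the multiple of \<open>kappa\<close> that agrees with \<open>f\<close> on
  one edge leaves a cycle with a zero. At a vertex of degree 2 a cycle that is zero on one edge is
  zero on the other, and \<open>C\<close> is connected.\<close>

lemma cycle_eq_multiple_of_kappa:
  fixes f :: "'a \<Rightarrow> 'a \<Rightarrow> 'f"
  assumes f: "chain1 adj f" and supp: "\<And>x y. f x y \<noteq> 0 \<Longrightarrow> x \<in> C \<and> y \<in> C"
    and cycle: "\<And>y. (\<Sum>t\<in>V. f t y) = 0"
  obtains a where "\<And>x y. f x y = a * kappa x y"
proof -
  obtain c where c: "c \<in> C" using C_nonempty by blast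
  have "{x\<in>C. adj c x} \<noteq> {}" using degree_2[OF c] by fastforce
  then obtain x where x: "x \<in> C" "adj c x" by blast
  define a where "a = f c x / kappa c x"
  define g where "g s t = f s t - a * kappa s t" for s t
  have g_swap: "g s t = - g t s" for s t
  proof -
    have "f s t = - f t s" "kappa s t = - kappa t s" using f chain1_kappa unfolding chain1_def by blast+
    then show ?thesis unfolding g_def by simp
  qed
  have g_supp: "s \<in> C \<and> t \<in> C \<and> adj s t" if "g s t \<noteq> 0" for s t
  proof -
    have "f s t \<noteq> 0 \<or> kappa s t \<noteq> 0" using that unfolding g_def by auto
    moreover have "adj s t" if "f s t \<noteq> 0 \<or> kappa s t \<noteq> 0"
      using that f chain1_kappa unfolding chain1_def by blast
    moreover have "s \<in> C \<and> t \<in> C" if "kappa s t \<noteq> 0" using that unfolding kappa_def by meson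
    ultimately show ?thesis using supp by blast
  qed
  have g_cycle: "(\<Sum>t\<in>V. g t y) = 0" for y
    unfolding g_def by (simp add: sum_subtractf cycle kappa_cycle flip: sum_distrib_left)
  have local: "g s q = 0" if s: "s \<in> C" "p \<in> C" "adj s p" "g s p = 0" for s p q
  proof (rule ccontr)
    assume ne: "g s q \<noteq> 0"
    then have q: "q \<in> C" "adj s q" "q \<noteq> p" using g_supp s by blast+
    have "{p, q} \<subseteq> {x\<in>C. adj s x}" "card {p, q} = 2" using q s by auto
    moreover have "finite {x\<in>C. adj s x}" using finite_subset[OF sub(3) finite_V] by simp
    ultimately have nb: "{x\<in>C. adj s x} = {p, q}" using card_subset_eq degree_2[OF s(1)] by metis
    have "(\<Sum>t\<in>V. g t s) = (\<Sum>t\<in>{p, q}. g t s)"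
    proof (rule sum.mono_neutral_right[OF finite_V])
      show "{p, q} \<subseteq> V" using q s sub by blast
      show "\<forall>t\<in>V - {p, q}. g t s = 0" using g_supp adj_sym nb by blast
    qed
    then have "g p s + g q s = 0" using q g_cycle by simp
    then show False using ne s(4) g_swap[of p s] g_swap[of q s] by simp
  qed
  have "g s t = 0" for s t
  proof (rule ccontr)
    assume ne: "g s t \<noteq> 0"
    have "\<forall>t. g s t = 0"
    proof (rule cut_connected_propagate[OF connected_C c, of "\<lambda>s. \<forall>t. g s t = 0"])
      have "g c x = 0" unfolding g_def a_def using kappa_nonzero[OF c x] by simp
      then show "\<forall>t. g c t = 0" using local[OF c x] by blast
      show "s \<in> C" using g_supp ne by blast
      fix p q assume pq: "p \<in> C" "q \<in> C" "\<forall>t. g p t = 0" "adj p q"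
      have "g q p = 0" using g_swap[of q p] pq(3) by simp
      then show "\<forall>t. g q t = 0" using local[OF pq(2,1) adj_sym[OF pq(4)]] by blast
    qed
    then show False using ne by blast
  qed
  then show thesis using that[of a] unfolding g_def by simp
qed

end

section \<open>Linear algebra of chains and criteria for homology groups\<close>

lemma boundary_map_diff:
  "boundary_map K (\<lambda>xs. c xs - d xs) = (\<lambda>xs. boundary_map K c xs - boundary_map K d xs)"
  unfolding boundary_map_def by (simp add: sum_subtractf)

lemma boundary_map_scale:
  "boundary_map K (\<lambda>xs. a * c xs) = (\<lambda>xs. a * boundary_map K c xs)"
  unfolding boundary_map_def by (simp add: sum_distrib_left)

lemma boundary_map_zero [simp]: "boundary_map K (\<lambda>_. 0) = (\<lambda>_. 0)"
  unfolding boundary_map_def by simp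

lemma chains_zero [simp]: "(\<lambda>_. 0) \<in> chains K i"
  unfolding chains_def by simp

lemma chains_swap: "c \<in> chains K i \<Longrightarrow> c (xs @ x # y # ys) = - c (xs @ y # x # ys)"
  unfolding chains_def by blast

lemma chains_support:
  "c \<in> chains K i \<Longrightarrow> c xs \<noteq> 0 \<Longrightarrow> distinct xs \<and> set xs \<in> K \<and> int (length xs) = i + 1"
  unfolding chains_def by blast

lemma chainsI:
  assumes "\<And>xs. c xs \<noteq> 0 \<Longrightarrow> distinct xs \<and> set xs \<in> K \<and> int (length xs) = i + 1"
    and "\<And>xs x y ys. c (xs @ x # y # ys) = - c (xs @ y # x # ys)"
  shows "c \<in> chains K i"
  using assms unfolding chains_def by blast

lemma chains_diff:
  assumes "c \<in> chains K i" "d \<in> chains K i"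
  shows "(\<lambda>xs. c xs - d xs) \<in> chains K i"
proof (rule chainsI)
  fix xs assume "c xs - d xs \<noteq> 0"
  then have "c xs \<noteq> 0 \<or> d xs \<noteq> 0" by auto
  then show "distinct xs \<and> set xs \<in> K \<and> int (length xs) = i + 1"
    using assms chains_support by blast
next
  fix xs x y ys
  show "c (xs @ x # y # ys) - d (xs @ x # y # ys) = - (c (xs @ y # x # ys) - d (xs @ y # x # ys))"
    using chains_swap[OF assms(1), of xs x y ys] chains_swap[OF assms(2), of xs x y ys] by simp
qed

lemma chains_scale:
  assumes "c \<in> chains K i"
  shows "(\<lambda>xs. a * c xs) \<in> chains K i"
proof (rule chainsI)
  fix xs assume "a * c xs \<noteq> 0"
  then show "distinct xs \<and> set xs \<in> K \<and> int (length xs) = i + 1"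
    using assms chains_support by fastforce
next
  fix xs x y ys
  show "a * c (xs @ x # y # ys) = - (a * c (xs @ y # x # ys))"
    using chains_swap[OF assms, of xs x y ys] by simp
qed

lemma cycles_zero [simp]: "(\<lambda>_. 0) \<in> cycles K i"
  unfolding cycles_def by simp

lemma boundaries_zero [simp]: "(\<lambda>_. 0) \<in> boundaries K i"
  unfolding boundaries_def by (rule image_eqI[of _ _ "\<lambda>_. 0"]) simp_all

lemma cycles_diff: "c \<in> cycles K i \<Longrightarrow> d \<in> cycles K i \<Longrightarrow> (\<lambda>xs. c xs - d xs) \<in> cycles K i"
  unfolding cycles_def by (simp add: chains_diff boundary_map_diff)

lemma cycles_scale: "c \<in> cycles K i \<Longrightarrow> (\<lambda>xs. a * c xs) \<in> cycles K i"
  unfolding cycles_def by (simp add: chains_scale boundary_map_scale)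

lemma mem_homology_class:
  "d \<in> homology_class K i c \<longleftrightarrow>
    c \<in> cycles K i \<and> d \<in> cycles K i \<and> (\<lambda>xs. c xs - d xs) \<in> boundaries K i"
  unfolding homology_class_def homologous_def by blast

lemma homology_class_refl: "c \<in> cycles K i \<Longrightarrow> c \<in> homology_class K i c"
  by (simp add: mem_homology_class)

lemma reduced_homology_eq: "reduced_homology K i = homology_class K i ` cycles K i"
  unfolding reduced_homology_def homology_class_def quotient_def by blast

lemma homology_vanishes_iff:
  "homology_vanishes TYPE('f::field) K i \<longleftrightarrow>
    cycles K i \<subseteq> (boundaries K i :: ('a list \<Rightarrow> 'f) set)"
proof
  assume van: "homology_vanishes TYPE('f) K i"
  show "cycles K i \<subseteq> (boundaries K i :: ('a list \<Rightarrow> 'f) set)"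
  proof
    fix c :: "'a list \<Rightarrow> 'f" assume c: "c \<in> cycles K i"
    then have "homology_class K i c = homology_class K i (\<lambda>_. 0)"
      using van unfolding homology_vanishes_def reduced_homology_eq by blast
    then have "(\<lambda>_. 0) \<in> homology_class K i c" using homology_class_refl[OF cycles_zero] by simp
    then show "c \<in> boundaries K i" by (simp add: mem_homology_class)
  qed
next
  assume sub: "cycles K i \<subseteq> (boundaries K i :: ('a list \<Rightarrow> 'f) set)"
  have eq: "homology_class K i c = cycles K i" if "c \<in> cycles K i" for c :: "'a list \<Rightarrow> 'f"
    using that cycles_diff[OF that] subsetD[OF sub] unfolding set_eq_iff mem_homology_class by blast
  have zero: "(\<lambda>_. 0 :: 'f) \<in> cycles K i" by simp
  have "homology_class K i ` (cycles K i :: ('a list \<Rightarrow> 'f) set) = (\<lambda>_. cycles K i) ` (cycles K i :: ('a list \<Rightarrow> 'f) set)"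
    by (rule image_cong[OF refl eq])
  also have "\<dots> = {homology_class K i (\<lambda>_. 0)}" unfolding eq[OF zero] using zero by blast
  finally show "homology_vanishes TYPE('f) K i"
    unfolding homology_vanishes_def reduced_homology_eq .
qed

text \<open>\<open>z\<close> represents the class with value 1 under \<open>\<phi>\<close>. It is
  not the zero chain, as \<open>\<phi>\<close> sends the zero class to 0, and the scalar for
  \<open>c\<close> is the value of its class.\<close>

lemma homology_is_field_generator:
  assumes "homology_is_field TYPE('f::field) K i"
  obtains z :: "'a list \<Rightarrow> 'f::field" where "z \<in> cycles K i" "z \<noteq> (\<lambda>_. 0)"
    "\<And>c. c \<in> cycles K i \<Longrightarrow> \<exists>a. (\<lambda>xs. a * z xs - c xs) \<in> boundaries K i"
proof -
  obtain \<phi> :: "('a list \<Rightarrow> 'f) set \<Rightarrow> 'f" where bij: "bij_betw \<phi> (reduced_homology K i) UNIV"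
    and add: "\<And>c d. c \<in> cycles K i \<Longrightarrow> d \<in> cycles K i \<Longrightarrow>
      \<phi> (homology_class K i (\<lambda>xs. c xs + d xs)) = \<phi> (homology_class K i c) + \<phi> (homology_class K i d)"
    and scale: "\<And>a c. c \<in> cycles K i \<Longrightarrow>
      \<phi> (homology_class K i (\<lambda>xs. a * c xs)) = a * \<phi> (homology_class K i c)"
    using assms unfolding homology_is_field_def by blast
  obtain z where z: "z \<in> cycles K i" "\<phi> (homology_class K i z) = 1"
    using bij unfolding bij_betw_def reduced_homology_eq by (metis UNIV_I imageE)
  have "\<phi> (homology_class K i (\<lambda>_. 0)) = 0" using scale[OF cycles_zero, of 0] by simp
  then have "z \<noteq> (\<lambda>_. 0)" using z by auto
  moreover have "\<exists>a. (\<lambda>xs. a * z xs - c xs) \<in> boundaries K i" if c: "c \<in> cycles K i" for c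
  proof -
    let ?a = "\<phi> (homology_class K i c)"
    have "\<phi> (homology_class K i (\<lambda>xs. ?a * z xs)) = ?a" using scale[OF z(1), of ?a] z(2) by simp
    then have "homology_class K i (\<lambda>xs. ?a * z xs) = homology_class K i c"
      using bij cycles_scale[OF z(1)] c unfolding bij_betw_def reduced_homology_eq
      by (meson image_eqI inj_onD)
    then have "c \<in> homology_class K i (\<lambda>xs. ?a * z xs)" using homology_class_refl[OF c] by simp
    then show ?thesis unfolding mem_homology_class by blast
  qed
  ultimately show thesis using that z(1) by blast
qed

text \<open>Without chains one degree higher, homology classes are single cycles, and the
  isomorphism reads off the coefficient at \<open>xs0\<close> relative to that of
  \<open>z\<close>.\<close>

lemma homology_is_fieldI:
  fixes z :: "'a list \<Rightarrow> 'f::field"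
  assumes z: "z \<in> cycles K i" "z xs0 \<noteq> 0"
    and top: "chains K (i + 1) \<subseteq> {\<lambda>_. (0 :: 'f)}"
    and multiple: "\<And>c. c \<in> cycles K i \<Longrightarrow> \<exists>a. \<forall>xs. c xs = a * z xs"
  shows "homology_is_field TYPE('f) K i"
proof -
  have bd: "boundaries K i = {\<lambda>_. (0 :: 'f)}"
    using top boundaries_zero[of K i] unfolding boundaries_def by force
  have class_single: "homology_class K i c = {c}" if "c \<in> cycles K i" for c :: "'a list \<Rightarrow> 'f"
  proof -
    have "(\<lambda>xs. c xs - d xs) = (\<lambda>_. 0) \<longleftrightarrow> d = c" for d by (auto simp: fun_eq_iff)
    then show ?thesis using that by (auto simp: set_eq_iff mem_homology_class bd)
  qed
  define \<phi> where "\<phi> X = the_elem X xs0 / z xs0" for X :: "('a list \<Rightarrow> 'f) set"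
  have \<phi>: "\<phi> (homology_class K i c) = c xs0 / z xs0" if "c \<in> cycles K i" for c
    unfolding \<phi>_def class_single[OF that] by simp
  have sum: "(\<lambda>xs. c xs + d xs) \<in> cycles K i" if "c \<in> cycles K i" "d \<in> cycles K i"
    for c d :: "'a list \<Rightarrow> 'f"
    using cycles_diff[OF that(1) cycles_scale[OF that(2), of "-1"]] by simp
  have "inj_on \<phi> (reduced_homology K i)"
  proof (rule inj_onI)
    fix X Y assume "X \<in> reduced_homology K i" "Y \<in> reduced_homology K i" and eq: "\<phi> X = \<phi> Y"
    then obtain c d where c: "c \<in> cycles K i" "X = homology_class K i c"
      and d: "d \<in> cycles K i" "Y = homology_class K i d"
      unfolding reduced_homology_eq by blast
    obtain a b where ab: "\<And>xs. c xs = a * z xs" "\<And>xs. d xs = b * z xs"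
      using multiple[OF c(1)] multiple[OF d(1)] by blast
    have "a = b" using eq z(2) unfolding c(2) d(2) \<phi>[OF c(1)] \<phi>[OF d(1)] by (simp add: ab)
    then have "c = d" using ab by auto
    then show "X = Y" using c d by simp
  qed
  moreover have "\<phi> ` reduced_homology K i = UNIV"
  proof -
    have "a \<in> \<phi> ` reduced_homology K i" for a
      unfolding reduced_homology_eq
      using \<phi>[OF cycles_scale[OF z(1), of a]] z(2) cycles_scale[OF z(1), of a] by force
    then show ?thesis by blast
  qed
  ultimately have "bij_betw \<phi> (reduced_homology K i) UNIV" unfolding bij_betw_def by blast
  then show ?thesis
    unfolding homology_is_field_def
    by (intro exI[of _ \<phi>]) (simp add: \<phi> sum cycles_scale add_divide_distrib)
qed

lemma chains_trivial:
  assumes "\<And>\<sigma>. \<sigma> \<in> K \<Longrightarrow> int (card \<sigma>) \<noteq> i + 1"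
  shows "chains K i \<subseteq> {\<lambda>_. 0}"
proof
  fix c :: "'a list \<Rightarrow> 'b" assume c: "c \<in> chains K i"
  have "c xs = 0" for xs
    using chains_support[OF c, of xs] assms distinct_card[of xs] by metis
  then show "c \<in> {\<lambda>_. 0}" by auto
qed

lemma homology_vanishes_below:
  assumes "i < -1"
  shows "homology_vanishes TYPE('f::field) K i"
proof -
  have "chains K i \<subseteq> {\<lambda>_. 0 :: 'f}" by (rule chains_trivial) (use assms in linarith)
  then show ?thesis
    unfolding homology_vanishes_iff using boundaries_zero[of K i] unfolding cycles_def by blast
qed

section \<open>Degrees -1, 0 and 1 in terms of coefficient functions\<close>

definition lift0 :: "('a \<Rightarrow> 'f::field) \<Rightarrow> 'a list \<Rightarrow> 'f" where
  "lift0 f xs = (case xs of [x] \<Rightarrow> f x | _ \<Rightarrow> 0)"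

definition lift1 :: "('a \<Rightarrow> 'a \<Rightarrow> 'f::field) \<Rightarrow> 'a list \<Rightarrow> 'f" where
  "lift1 k xs = (case xs of [x, y] \<Rightarrow> k x y | _ \<Rightarrow> 0)"

lemma lift0_simps [simp]: "lift0 f [x] = f x" "lift0 f [] = 0" "lift0 f (x # y # ys) = 0"
  by (simp_all add: lift0_def)

lemma lift1_simps [simp]: "lift1 k [x, y] = k x y" "lift1 k [] = 0" "lift1 k [x] = 0"
  "lift1 k (x # y # z # ys) = 0"
  by (simp_all add: lift1_def)

lemma lift0_nonzero: "lift0 f xs \<noteq> 0 \<Longrightarrow> \<exists>x. xs = [x] \<and> f x \<noteq> 0"
  unfolding lift0_def by (auto split: list.splits)

lemma lift1_nonzero: "lift1 k xs \<noteq> 0 \<Longrightarrow> \<exists>x y. xs = [x, y] \<and> k x y \<noteq> 0"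
  unfolding lift1_def by (auto split: list.splits)

lemma lift0_chain:
  assumes "\<And>x. f x \<noteq> 0 \<Longrightarrow> {x} \<in> K"
  shows "lift0 f \<in> chains K 0"
proof (rule chainsI)
  fix xs assume "lift0 f xs \<noteq> 0"
  then show "distinct xs \<and> set xs \<in> K \<and> int (length xs) = 0 + 1"
    using lift0_nonzero[of f xs] assms by auto
next
  fix xs x y ys
  have "lift0 f (xs @ a # b # ys) = 0" for a b using lift0_nonzero[of f "xs @ a # b # ys"] by auto
  then show "lift0 f (xs @ x # y # ys) = - lift0 f (xs @ y # x # ys)" by simp
qed

lemma lift1_chain:
  assumes "chain1 (adjacent K) k"
  shows "lift1 k \<in> chains K 1"
proof (rule chainsI)
  fix xs assume "lift1 k xs \<noteq> 0"
  then obtain x y where "xs = [x, y]" "adjacent K x y"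
    using lift1_nonzero[of k xs] assms unfolding chain1_def by blast
  then show "distinct xs \<and> set xs \<in> K \<and> int (length xs) = 1 + 1" unfolding adjacent_def by simp
next
  fix xs x y ys
  show "lift1 k (xs @ x # y # ys) = - lift1 k (xs @ y # x # ys)"
  proof (cases "xs = [] \<and> ys = []")
    case True
    moreover have "k x y = - k y x" using assms unfolding chain1_def by blast
    ultimately show ?thesis by simp
  next
    case False
    then have "lift1 k (xs @ a # b # ys) = 0" for a b
      using lift1_nonzero[of k "xs @ a # b # ys"] by (auto simp: append_eq_Cons_conv)
    then show ?thesis by simp
  qed
qed

lemma chain1_of_chains:
  assumes "c \<in> chains K 1"
  shows "chain1 (adjacent K) (\<lambda>x y. c [x, y])"
  unfolding chain1_def
proof (intro allI conjI impI)
  fix x y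
  show "c [x, y] = - c [y, x]" using chains_swap[OF assms, of "[]" x y "[]"] by simp
  assume "c [x, y] \<noteq> 0"
  then show "adjacent K x y" using chains_support[OF assms] unfolding adjacent_def by fastforce
qed

lemma chain2_of_chains:
  assumes c: "c \<in> chains K 2" and K: "simplicial_complex K"
  shows "chain2 (adjacent K) (\<lambda>x y z. c [x, y, z])"
  unfolding chain2_def
proof (intro allI conjI impI)
  fix x y z
  show "c [x, y, z] = - c [y, x, z]" using chains_swap[OF c, of "[]" x y "[z]"] by simp
  show "c [x, y, z] = - c [x, z, y]" using chains_swap[OF c, of "[x]" y z "[]"] by simp
  assume "c [x, y, z] \<noteq> 0"
  then have xyz: "x \<noteq> y" "y \<noteq> z" "x \<noteq> z" "{x, y, z} \<in> K" using chains_support[OF c] by fastforce+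
  then have "{x, y} \<in> K" "{y, z} \<in> K" "{x, z} \<in> K"
    using K unfolding simplicial_complex_def by (meson insertCI insert_subsetI empty_subsetI)+
  then show "adjacent K x y" "adjacent K y z" "adjacent K x z" using xyz unfolding adjacent_def by auto
qed

lemma chains_1_eq_lift1: "c \<in> chains K 1 \<Longrightarrow> c xs = lift1 (\<lambda>x y. c [x, y]) xs"
  using chains_support[of c K 1 xs] unfolding lift1_def
  by (cases "c xs = 0") (auto split: list.splits)

lemma chains_0_eq_lift0: "c \<in> chains K 0 \<Longrightarrow> c xs = lift0 (\<lambda>x. c [x]) xs"
  using chains_support[of c K 0 xs] unfolding lift0_def
  by (cases "c xs = 0") (auto split: list.splits)

lemma finite_vertices: "simplicial_complex K \<Longrightarrow> finite (vertices K)"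
  unfolding simplicial_complex_def vertices_def by blast

lemma face_subset: "simplicial_complex K \<Longrightarrow> \<sigma> \<in> K \<Longrightarrow> \<tau> \<subseteq> \<sigma> \<Longrightarrow> \<tau> \<in> K"
  unfolding simplicial_complex_def by blast

lemma singleton_face_iff: "simplicial_complex K \<Longrightarrow> {x} \<in> K \<longleftrightarrow> x \<in> vertices K"
  unfolding vertices_def using face_subset[of K _ "{x}"] by blast

lemma adjacent_sym: "adjacent K x y \<Longrightarrow> adjacent K y x"
  unfolding adjacent_def by (auto simp: insert_commute)

lemma adjacent_vertex: "adjacent K x y \<Longrightarrow> x \<in> vertices K"
  unfolding adjacent_def vertices_def by blast

lemma boundary_lift0: "boundary_map K (lift0 f) = (\<lambda>xs. if xs = [] then \<Sum>x\<in>vertices K. f x else 0)"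
proof
  fix xs show "boundary_map K (lift0 f) xs = (if xs = [] then \<Sum>x\<in>vertices K. f x else 0)"
    unfolding boundary_map_def by (cases xs) simp_all
qed

lemma boundary_lift1: "boundary_map K (lift1 k) = lift0 (\<lambda>y. \<Sum>x\<in>vertices K. k x y)"
proof
  fix xs show "boundary_map K (lift1 k) xs = lift0 (\<lambda>y. \<Sum>x\<in>vertices K. k x y) xs"
  proof (cases xs)
    case (Cons y ys)
    then show ?thesis unfolding boundary_map_def by (cases ys) simp_all
  qed (simp add: boundary_map_def)
qed

text \<open>The chain with value 1 on the empty ordering is a cycle; it is the boundary of any
  vertex, and without vertices only 0 is a boundary.\<close>

lemma homology_minus_1_vanishes_iff:
  assumes K: "simplicial_complex K"
  shows "homology_vanishes TYPE('f::field) K (-1) \<longleftrightarrow> vertices K \<noteq> {}"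
proof
  assume van: "homology_vanishes TYPE('f) K (-1)"
  define c :: "'a list \<Rightarrow> 'f" where "c xs = of_bool (xs = [])" for xs
  have "c \<in> chains K (-1)"
    by (rule chainsI) (use K in \<open>auto simp: c_def simplicial_complex_def split: if_splits\<close>)
  moreover have "boundary_map K c = (\<lambda>_. 0)" unfolding boundary_map_def c_def by simp
  ultimately have "c \<in> boundaries K (-1)" using van unfolding homology_vanishes_iff cycles_def by blast
  then obtain d where d: "c = boundary_map K d" unfolding boundaries_def by blast
  have "(\<Sum>x\<in>vertices K. d [x]) = c []"
    using fun_cong[OF d, of "[]"] unfolding boundary_map_def by (rule sym)
  then have "(\<Sum>x\<in>vertices K. d [x]) = 1" unfolding c_def by simp
  then show "vertices K \<noteq> {}" by auto
next
  assume "vertices K \<noteq> {}"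
  then obtain p where p: "p \<in> vertices K" by blast
  show "homology_vanishes TYPE('f) K (-1)"
    unfolding homology_vanishes_iff
  proof
    fix c :: "'a list \<Rightarrow> 'f" assume "c \<in> cycles K (-1)"
    then have c: "c xs = 0" if "xs \<noteq> []" for xs
      using that chains_support[of c K "-1" xs] unfolding cycles_def by fastforce
    let ?d = "lift0 (\<lambda>x. if x = p then c [] else 0)"
    have "?d \<in> chains K 0"
    proof (rule lift0_chain)
      fix x assume "(if x = p then c [] else 0) \<noteq> 0"
      then have "x = p" by meson
      then show "{x} \<in> K" using p singleton_face_iff[OF K] by blast
    qed
    moreover have "boundary_map K ?d xs = c xs" for xs
      unfolding boundary_lift0 using p c[of xs] finite_vertices[OF K] by (cases "xs = []") simp_all
    then have "c = boundary_map K ?d" by (intro ext) simp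
    ultimately show "c \<in> boundaries K (-1)" unfolding boundaries_def by simp
  qed
qed

text \<open>For \<open>a\<close> and \<open>b\<close> on different sides of a cut, the 0-cycle
  \<open>a\<close> minus \<open>b\<close> sums to 1 over the side of \<open>a\<close>, while a
  boundary sums to 0 there if no edge crosses.\<close>

lemma homology_0_vanishes_connected:
  assumes K: "simplicial_complex K" and van: "homology_vanishes TYPE('f::field) K 0"
  shows "cut_connected (adjacent K) (vertices K)"
  unfolding cut_connected_def
proof (intro allI impI, rule ccontr)
  fix T assume T: "T \<subseteq> vertices K" "T \<noteq> {}" "T \<noteq> vertices K"
    and no: "\<not> (\<exists>a\<in>T. \<exists>b\<in>vertices K - T. adjacent K a b)"
  obtain a b where ab: "a \<in> T" "b \<in> vertices K" "b \<notin> T" using T by blast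
  define f :: "'a \<Rightarrow> 'f" where "f x = of_bool (x = a) - of_bool (x = b)" for x
  have fin: "finite (vertices K)" "finite T"
    using finite_vertices[OF K] finite_subset[OF T(1)] by blast+
  have aV: "a \<in> vertices K" using ab T by blast
  have "lift0 f \<in> chains K 0"
  proof (rule lift0_chain)
    fix x assume "f x \<noteq> 0"
    then have "x = a \<or> x = b" unfolding f_def by (auto split: if_splits)
    then show "{x} \<in> K" using ab aV singleton_face_iff[OF K] by blast
  qed
  moreover have "(\<Sum>x\<in>vertices K. f x) = 0"
    unfolding f_def by (simp add: sum_subtractf of_bool_def fin aV ab)
  then have "boundary_map K (lift0 f) = (\<lambda>_. 0)" unfolding boundary_lift0 by auto
  ultimately have "lift0 f \<in> boundaries K 0" using van unfolding homology_vanishes_iff cycles_def by blast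
  then obtain d where d: "d \<in> chains K 1" "lift0 f = boundary_map K d" unfolding boundaries_def by auto
  have d1: "chain1 (adjacent K) (\<lambda>x y. d [x, y])" by (rule chain1_of_chains[OF d(1)])
  have fd: "f x = (\<Sum>t\<in>vertices K. d [t, x])" for x
    using fun_cong[OF d(2), of "[x]"] unfolding boundary_map_def by simp
  have "(\<Sum>x\<in>T. f x) = (\<Sum>x\<in>T. \<Sum>t\<in>vertices K. d [t, x])" using fd by simp
  also have "\<dots> = 0"
  proof (rule sum_antisymmetric_closed[OF fin(1) T(1)])
    show "d [x, y] = - d [y, x]" for x y using d1 unfolding chain1_def by blast
    show "d [x, x] = 0" for x using d1 unfolding chain1_def adjacent_def by blast
    fix x t assume "x \<in> T" "t \<in> vertices K - T"
    then have "\<not> adjacent K t x" using no adjacent_sym[of K t x] by blast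
    then show "d [t, x] = 0" using d1 unfolding chain1_def by metis
  qed
  finally have "(\<Sum>x\<in>T. f x) = 0" .
  moreover have "(\<Sum>x\<in>T. f x) = 1" unfolding f_def using ab fin by (simp add: sum_subtractf of_bool_def)
  ultimately show False by simp
qed

text \<open>Path chains from a base vertex \<open>s\<close> to all vertices are weighted with the
  coefficients of \<open>c\<close>. The contributions at \<open>s\<close> cancel because these
  coefficients sum to 0.\<close>

lemma connected_homology_0_vanishes:
  assumes K: "simplicial_complex K" and conn: "cut_connected (adjacent K) (vertices K)"
  shows "homology_vanishes TYPE('f::field) K 0"
  unfolding homology_vanishes_iff
proof
  fix c :: "'a list \<Rightarrow> 'f" assume "c \<in> cycles K 0"
  then have c: "c \<in> chains K 0" "boundary_map K c = (\<lambda>_. 0)" unfolding cycles_def by blast+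
  have sum0: "(\<Sum>y\<in>vertices K. c [y]) = 0" using fun_cong[OF c(2), of "[]"] unfolding boundary_map_def by simp
  have fin: "finite (vertices K)" by (rule finite_vertices[OF K])
  have c_vertex: "y \<in> vertices K" if "c [y] \<noteq> 0" for y
    using chains_support[OF c(1) that] singleton_face_iff[OF K] by simp
  show "c \<in> boundaries K 0"
  proof (cases "vertices K = {}")
    case True
    then have c0: "c [y] = 0" for y using c_vertex by blast
    have "c xs = 0" for xs
      unfolding chains_0_eq_lift0[OF c(1), of xs] lift0_def by (simp add: c0 split: list.split)
    then have "c = (\<lambda>_. 0)" by blast
    then show ?thesis using boundaries_zero by metis
  next
    case False
    then obtain s where s: "s \<in> vertices K" by blast
    have adj: "x \<in> vertices K \<and> adjacent K y x" if "adjacent K x y" for x y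
      using adjacent_sym[OF that] adjacent_vertex[OF that] by blast
    have "\<exists>k :: 'a \<Rightarrow> 'a \<Rightarrow> 'f. chain1 (adjacent K) k \<and>
        (\<forall>y. (\<Sum>t\<in>vertices K. k t y) = of_bool (y = b) - of_bool (y = s))" if b: "b \<in> vertices K" for b
    proof -
      obtain k :: "'a \<Rightarrow> 'a \<Rightarrow> 'f" where "chain1 (adjacent K) k"
        "\<And>x y. k x y \<noteq> 0 \<Longrightarrow> x \<in> vertices K \<and> y \<in> vertices K"
        "\<And>y. (\<Sum>t\<in>vertices K. k t y) = of_bool (y = b) - of_bool (y = s)"
        using path_chain[OF fin adj conn s b] by blast
      then show ?thesis by blast
    qed
    then obtain k :: "'a \<Rightarrow> 'a \<Rightarrow> 'a \<Rightarrow> 'f" where k: "\<And>b. b \<in> vertices K \<Longrightarrow> chain1 (adjacent K) (k b)"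
      "\<And>b y. b \<in> vertices K \<Longrightarrow> (\<Sum>t\<in>vertices K. k b t y) = of_bool (y = b) - of_bool (y = s)"
      by metis
    define l where "l x y = (\<Sum>b\<in>vertices K. c [b] * k b x y)" for x y
    have "chain1 (adjacent K) l"
      unfolding chain1_def
    proof (intro allI conjI impI)
      fix x y
      show "l x y = - l y x"
        unfolding l_def sum_negf[symmetric]
      proof (rule sum.cong[OF refl])
        fix b assume "b \<in> vertices K"
        then have "k b x y = - k b y x" using k(1) unfolding chain1_def by blast
        then show "c [b] * k b x y = - (c [b] * k b y x)" by simp
      qed
      assume "l x y \<noteq> 0"
      then obtain b where "b \<in> vertices K" "c [b] * k b x y \<noteq> 0"
        unfolding l_def by (rule sum.not_neutral_contains_not_neutral)
      then show "adjacent K x y" using k(1) unfolding chain1_def by (metis mult_zero_right)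
    qed
    then have "lift1 l \<in> chains K 1" by (rule lift1_chain)
    moreover have "boundary_map K (lift1 l) = c"
    proof
      fix xs
      have "(\<Sum>t\<in>vertices K. l t y) = c [y]" for y
      proof -
        have "(\<Sum>t\<in>vertices K. l t y) = (\<Sum>b\<in>vertices K. c [b] * (\<Sum>t\<in>vertices K. k b t y))"
          unfolding l_def sum_distrib_left by (rule sum.swap)
        also have "\<dots> = (\<Sum>b\<in>vertices K. c [b] * of_bool (y = b) - c [b] * of_bool (y = s))"
          by (rule sum.cong) (simp_all add: k(2) right_diff_distrib)
        also have "\<dots> = (\<Sum>b\<in>vertices K. c [b] * of_bool (y = b))"
          by (simp add: sum_subtractf sum0 flip: sum_distrib_right)
        also have "\<dots> = c [y]"
          using fin c_vertex[of y] by (auto simp: of_bool_def if_distrib cong: if_cong)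
        finally show ?thesis .
      qed
      then show "boundary_map K (lift1 l) xs = c xs"
        unfolding boundary_lift1 chains_0_eq_lift0[OF c(1), of xs] by simp
    qed
    ultimately show ?thesis unfolding boundaries_def by force
  qed
qed

section \<open>Flag spheres and equators\<close>

lemma simplicial_complex_link:
  assumes "simplicial_complex K" "\<sigma> \<in> K"
  shows "simplicial_complex (link K \<sigma>)"
  unfolding simplicial_complex_def
proof (intro conjI ballI allI impI)
  show "finite (link K \<sigma>)" using assms unfolding simplicial_complex_def link_def by simp
  show "{} \<in> link K \<sigma>" using assms unfolding simplicial_complex_def link_def by simp
  fix \<tau> assume \<tau>: "\<tau> \<in> link K \<sigma>"
  show "finite \<tau>" using \<tau> assms unfolding simplicial_complex_def link_def by blast
  fix \<rho> assume "\<rho> \<subseteq> \<tau>"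
  then have "\<rho> \<union> \<sigma> \<subseteq> \<tau> \<union> \<sigma>" "\<rho> \<inter> \<sigma> \<subseteq> \<tau> \<inter> \<sigma>" by blast+
  then show "\<rho> \<in> link K \<sigma>"
    using \<tau> \<open>\<rho> \<subseteq> \<tau>\<close> face_subset[OF assms(1)] unfolding link_def by blast
qed

lemma link_empty: "{} \<in> K \<Longrightarrow> link K {} = K"
  unfolding link_def by simp

lemma flag_clique:
  assumes "flag K" "S \<subseteq> vertices K" "\<And>x y. x \<in> S \<Longrightarrow> y \<in> S \<Longrightarrow> x \<noteq> y \<Longrightarrow> adjacent K x y"
  shows "S \<in> K"
proof -
  have "S \<in> cliques K" using assms(2,3) unfolding cliques_def by blast
  then show ?thesis using assms(1) unfolding flag_def by blast
qed

lemma face_adjacent: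
  assumes "simplicial_complex K" "\<sigma> \<in> K" "x \<in> \<sigma>" "y \<in> \<sigma>" "x \<noteq> y"
  shows "adjacent K x y"
  using face_subset[OF assms(1,2), of "{x, y}"] assms unfolding adjacent_def by blast

lemma adjacent_vertex_right: "adjacent K x y \<Longrightarrow> y \<in> vertices K"
  unfolding adjacent_def vertices_def by blast

lemma finite_face: "simplicial_complex K \<Longrightarrow> \<sigma> \<in> K \<Longrightarrow> finite \<sigma>"
  unfolding simplicial_complex_def by blast

lemma adjacent_irrefl: "\<not> adjacent K x x"
  unfolding adjacent_def by blast

lemma insert_face:
  assumes K: "flag K" and \<sigma>: "\<sigma> \<in> K" and t: "t \<in> vertices K" "\<And>s. s \<in> \<sigma> \<Longrightarrow> adjacent K s t"
  shows "insert t \<sigma> \<in> K"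
proof (rule flag_clique[OF K])
  have sc: "simplicial_complex K" using K unfolding flag_def by blast
  show "insert t \<sigma> \<subseteq> vertices K" using \<sigma> t unfolding vertices_def by blast
  fix x y assume "x \<in> insert t \<sigma>" "y \<in> insert t \<sigma>" "x \<noteq> y"
  then show "adjacent K x y"
    using t(2)[of x] t(2)[of y] adjacent_sym[of K y t] face_adjacent[OF sc \<sigma>, of x y] by blast
qed

lemma vertices_link:
  assumes K: "flag K" and \<sigma>: "\<sigma> \<in> K"
  shows "vertices (link K \<sigma>) = {t\<in>vertices K. \<forall>s\<in>\<sigma>. adjacent K s t}"
proof (intro equalityI subsetI)
  have sc: "simplicial_complex K" using K unfolding flag_def by blast
  fix t assume "t \<in> vertices (link K \<sigma>)"
  then obtain \<tau> where \<tau>: "t \<in> \<tau>" "\<tau> \<in> K" "\<tau> \<inter> \<sigma> = {}" "\<tau> \<union> \<sigma> \<in> K"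
    unfolding vertices_def link_def by blast
  have "adjacent K s t" if "s \<in> \<sigma>" for s
    by (rule face_adjacent[OF sc \<tau>(4)]) (use that \<tau> in blast)+
  then show "t \<in> {t\<in>vertices K. \<forall>s\<in>\<sigma>. adjacent K s t}" using \<tau> unfolding vertices_def by blast
next
  have sc: "simplicial_complex K" using K unfolding flag_def by blast
  fix t assume t: "t \<in> {t\<in>vertices K. \<forall>s\<in>\<sigma>. adjacent K s t}"
  then have "insert t \<sigma> \<in> K" using insert_face[OF K \<sigma>] by blast
  moreover have "t \<notin> \<sigma>" using t adjacent_irrefl[of K t] by blast
  moreover have "{t} \<in> K" using t singleton_face_iff[OF sc] by blast
  ultimately have "{t} \<in> link K \<sigma>" unfolding link_def by simp
  then show "t \<in> vertices (link K \<sigma>)" unfolding vertices_def by blast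
qed

text \<open>By flagness, \<open>p\<close> and \<open>q\<close> form a face together with
  \<open>\<sigma>\<close> as soon as all pairs are adjacent; so the link is determined by the
  graph.\<close>

lemma adjacent_link:
  assumes K: "flag K" and \<sigma>: "\<sigma> \<in> K"
  shows "adjacent (link K \<sigma>) p q \<longleftrightarrow>
    adjacent K p q \<and> p \<in> vertices (link K \<sigma>) \<and> q \<in> vertices (link K \<sigma>)"
proof
  assume "adjacent (link K \<sigma>) p q"
  then show "adjacent K p q \<and> p \<in> vertices (link K \<sigma>) \<and> q \<in> vertices (link K \<sigma>)"
    unfolding adjacent_def vertices_def link_def by blast
next
  assume pq: "adjacent K p q \<and> p \<in> vertices (link K \<sigma>) \<and> q \<in> vertices (link K \<sigma>)"
  then have p: "p \<in> vertices K" "\<And>s. s \<in> \<sigma> \<Longrightarrow> adjacent K s p"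
    and q: "q \<in> vertices K" "\<And>s. s \<in> \<sigma> \<Longrightarrow> adjacent K s q"
    unfolding vertices_link[OF assms] by blast+
  have "insert q \<sigma> \<in> K" by (rule insert_face[OF K \<sigma> q])
  then have "insert p (insert q \<sigma>) \<in> K"
    by (rule insert_face[OF K _ p(1)]) (use p(2) pq adjacent_sym[of K p q] in blast)
  moreover have "p \<notin> \<sigma>" "q \<notin> \<sigma>" using p(2)[of p] q(2)[of q] adjacent_irrefl[of K] by blast+
  ultimately show "adjacent (link K \<sigma>) p q" using pq unfolding adjacent_def link_def by simp
qed

lemma card_face_le:
  assumes "simplicial_complex K" "\<sigma> \<in> K"
  shows "int (card \<sigma>) \<le> dim_complex K + 1"
  using assms unfolding simplicial_complex_def dim_complex_def by simp

text \<open>The coefficients of the generator \<open>z\<close> sum to 0, so it is nonzero at two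
  vertices \<open>p\<close> and \<open>q\<close>. For a third vertex \<open>r\<close>, the cycle
  \<open>p\<close> minus \<open>r\<close> vanishes at \<open>q\<close> and is no multiple of
  \<open>z\<close>.\<close>

lemma two_vertices:
  assumes K: "simplicial_complex K" and field: "homology_is_field TYPE('f::field) K 0"
    and dim: "\<And>\<sigma>. \<sigma> \<in> K \<Longrightarrow> card \<sigma> \<le> 1"
  obtains p q where "p \<noteq> q" "vertices K = {p, q}"
proof -
  have fin: "finite (vertices K)" by (rule finite_vertices[OF K])
  have "chains K (0 + 1) \<subseteq> {\<lambda>_. 0 :: 'f}" by (rule chains_trivial) (use dim in force)
  then have bd: "boundaries K 0 \<subseteq> {\<lambda>_. 0 :: 'f}" unfolding boundaries_def by force
  obtain z :: "'a list \<Rightarrow> 'f" where z: "z \<in> cycles K 0" "z \<noteq> (\<lambda>_. 0)"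
    and gen: "\<And>c. c \<in> cycles K 0 \<Longrightarrow> \<exists>a. (\<lambda>xs. a * z xs - c xs) \<in> boundaries K 0"
    using homology_is_field_generator[OF field] by blast
  have zc: "z \<in> chains K 0" "boundary_map K z = (\<lambda>_. 0)" using z(1) unfolding cycles_def by blast+
  have z0: "(\<Sum>x\<in>vertices K. z [x]) = 0" using fun_cong[OF zc(2), of "[]"] unfolding boundary_map_def .
  obtain xs where "z xs \<noteq> 0" using z(2) by blast
  then have "length xs = 1" using chains_support[OF zc(1)] by fastforce
  then obtain p where p: "z [p] \<noteq> 0" using \<open>z xs \<noteq> 0\<close> by (metis One_nat_def length_0_conv length_Suc_conv)
  have z_vertex: "x \<in> vertices K" if "z [x] \<noteq> 0" for x
    using chains_support[OF zc(1) that] singleton_face_iff[OF K] by simp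
  have "\<exists>q\<in>vertices K - {p}. z [q] \<noteq> 0"
  proof (rule ccontr)
    assume "\<not> ?thesis"
    then have "(\<Sum>x\<in>vertices K. z [x]) = (\<Sum>x\<in>{p}. z [x])"
      by (intro sum.mono_neutral_right[OF fin]) (use z_vertex p in blast)+
    then show False using z0 p by simp
  qed
  then obtain q where q: "q \<noteq> p" "z [q] \<noteq> 0" by blast
  have "r \<in> {p, q}" if r: "r \<in> vertices K" for r
  proof (rule ccontr)
    assume r': "r \<notin> {p, q}"
    define f where "f x = (of_bool (x = p) - of_bool (x = r) :: 'f)" for x
    have "lift0 f \<in> chains K 0"
    proof (rule lift0_chain)
      fix x assume "f x \<noteq> 0"
      then have "x = p \<or> x = r" unfolding f_def by (auto split: if_splits)
      then show "{x} \<in> K" using r z_vertex[OF p] singleton_face_iff[OF K] by blast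
    qed
    moreover have "(\<Sum>x\<in>vertices K. f x) = 0"
      unfolding f_def using r z_vertex[OF p] fin by (simp add: sum_subtractf of_bool_def)
    then have "boundary_map K (lift0 f) = (\<lambda>_. 0)" unfolding boundary_lift0 by auto
    ultimately obtain a where "(\<lambda>xs. a * z xs - lift0 f xs) = (\<lambda>_. 0)"
      using gen[of "lift0 f"] bd unfolding cycles_def by blast
    then have "a * z [x] = f x" for x using fun_cong[of _ _ "[x]"] by fastforce
    then have "a * z [q] = 0" "a * z [p] = 1" using r' q(1) unfolding f_def by auto
    then show False using q(2) by simp
  qed
  then have "vertices K = {p, q}" using z_vertex p q by blast
  then show thesis using that q(1) by blast
qed

lemma homology_is_field_two_vertices:
  assumes K: "simplicial_complex K" and dim: "\<And>\<sigma>. \<sigma> \<in> K \<Longrightarrow> card \<sigma> \<le> 1"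
    and pq: "p \<noteq> q" "vertices K = {p, q}"
  shows "homology_is_field TYPE('f::field) K 0"
proof -
  define f where "f x = (of_bool (x = p) - of_bool (x = q) :: 'f)" for x
  have "lift0 f \<in> chains K 0"
  proof (rule lift0_chain)
    fix x assume "f x \<noteq> 0"
    then have "x \<in> vertices K" unfolding f_def pq by (auto split: if_splits)
    then show "{x} \<in> K" using singleton_face_iff[OF K] by blast
  qed
  moreover have "(\<Sum>x\<in>vertices K. f x) = 0" unfolding f_def pq using pq(1) by simp
  then have "boundary_map K (lift0 f) = (\<lambda>_. 0)" unfolding boundary_lift0 by auto
  ultimately have z: "lift0 f \<in> cycles K 0" unfolding cycles_def by blast
  show ?thesis
  proof (rule homology_is_fieldI[OF z, of "[p]"])
    show "lift0 f [p] \<noteq> 0" unfolding f_def using pq(1) by simp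
    show "chains K (0 + 1) \<subseteq> {\<lambda>_. 0 :: 'f}" by (rule chains_trivial) (use dim in force)
    fix c :: "'a list \<Rightarrow> 'f" assume "c \<in> cycles K 0"
    then have c: "c \<in> chains K 0" "boundary_map K c = (\<lambda>_. 0)" unfolding cycles_def by blast+
    have "c [p] + c [q] = 0"
      using fun_cong[OF c(2), of "[]"] pq unfolding boundary_map_def by simp
    then have cq: "c [q] = - c [p]" by (simp add: add_eq_0_iff)
    have other: "c [x] = 0" if "x \<notin> {p, q}" for x
      using that chains_support[OF c(1), of "[x]"] singleton_face_iff[OF K, of x] pq(2) by auto
    obtain a where a: "c [x] = a * f x" for x
    proof
      fix x show "c [x] = c [p] * f x" unfolding f_def using cq other[of x] pq(1) by auto
    qed
    have "c xs = a * lift0 f xs" for xs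
      unfolding chains_0_eq_lift0[OF c(1), of xs] lift0_def a by (auto split: list.split)
    then show "\<exists>a. \<forall>xs. c xs = a * lift0 f xs" by blast
  qed
qed

text \<open>\<open>{{}}\<close> is the sphere of dimension -1, the link of an edge in a
  cycle.\<close>

lemma homology_is_field_empty_face: "homology_is_field TYPE('f::field) {{}} (-1)"
proof -
  define z where "z xs = (of_bool (xs = []) :: 'f)" for xs :: "'a list"
  show ?thesis
  proof (rule homology_is_fieldI[of z _ _ "[]"])
    have "z \<in> chains {{}} (-1)" by (rule chainsI) (auto simp: z_def split: if_splits)
    moreover have "boundary_map {{}} z = (\<lambda>_. 0)" unfolding boundary_map_def z_def by simp
    ultimately show "z \<in> cycles {{}} (-1)" unfolding cycles_def by blast
    show "z [] \<noteq> 0" unfolding z_def by simp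
    show "chains {{}} (-1 + 1) \<subseteq> {\<lambda>_::'a list. 0 :: 'f}" by (rule chains_trivial) simp
    fix c :: "'a list \<Rightarrow> 'f" assume "c \<in> cycles {{}} (-1)"
    then have c: "c xs = 0" if "xs \<noteq> []" for xs
      using that chains_support[of c "{{}}" "-1" xs] unfolding cycles_def by fastforce
    have "c xs = c [] * z xs" for xs unfolding z_def using c[of xs] by simp
    then show "\<exists>a. \<forall>xs. c xs = a * z xs" by blast
  qed
qed

text \<open>The empty face yields \<open>Z\<close>, connectedness and the vanishing of the first
  homology; vertices yield their nonempty connected links; edges yield the two common
  neighbours.\<close>

lemma flag_sphere_surface_graph:
  assumes flag: "flag \<Delta>" and sphere: "homology_sphere TYPE('f::field) \<Delta>" and dim: "dim_complex \<Delta> = 2"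
  obtains Z :: "'a \<Rightarrow> 'a \<Rightarrow> 'a \<Rightarrow> 'f::field" where "surface_graph (vertices \<Delta>) (adjacent \<Delta>) Z"
proof -
  have sc: "simplicial_complex \<Delta>" using flag unfolding flag_def by blast
  have van: "homology_vanishes TYPE('f) (link \<Delta> \<sigma>) i" if "\<sigma> \<in> \<Delta>" "i < 2 - int (card \<sigma>)" for \<sigma> i
    using sphere that unfolding homology_sphere_def dim by blast
  have fld: "homology_is_field TYPE('f) (link \<Delta> \<sigma>) (2 - int (card \<sigma>))" if "\<sigma> \<in> \<Delta>" for \<sigma>
    using sphere that unfolding homology_sphere_def dim by blast
  have e: "{} \<in> \<Delta>" using sc unfolding simplicial_complex_def by blast
  have le3: "card \<sigma> \<le> 3" if "\<sigma> \<in> \<Delta>" for \<sigma> using card_face_le[OF sc that] dim by simp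
  have "homology_is_field TYPE('f) \<Delta> 2" using fld[OF e] link_empty[OF e] by simp
  then obtain z :: "'a list \<Rightarrow> 'f" where z: "z \<in> cycles \<Delta> 2" "z \<noteq> (\<lambda>_. 0)"
    by (rule homology_is_field_generator)
  have zc: "z \<in> chains \<Delta> 2" "boundary_map \<Delta> z = (\<lambda>_. 0)" using z(1) unfolding cycles_def by blast+
  define Z where "Z = (\<lambda>x y w. z [x, y, w])"
  have "surface_graph (vertices \<Delta>) (adjacent \<Delta>) Z"
  proof unfold_locales
    show "finite (vertices \<Delta>)" by (rule finite_vertices[OF sc])
    show "x \<in> vertices \<Delta>" if "adjacent \<Delta> x y" for x y using adjacent_vertex[OF that] .
    show "adjacent \<Delta> y x" if "adjacent \<Delta> x y" for x y using adjacent_sym[OF that] .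
    show "\<not> adjacent \<Delta> x x" for x by (rule adjacent_irrefl)
    show "cut_connected (adjacent \<Delta>) (vertices \<Delta>)"
      by (rule homology_0_vanishes_connected[OF sc]) (use van[OF e, of 0] link_empty[OF e] in simp)
    show "chain2 (adjacent \<Delta>) Z" unfolding Z_def by (rule chain2_of_chains[OF zc(1) sc])
    show "(\<Sum>t\<in>vertices \<Delta>. Z t x y) = 0" for x y
      using fun_cong[OF zc(2), of "[x, y]"] unfolding boundary_map_def Z_def .
    show "\<exists>x y w. Z x y w \<noteq> 0"
    proof -
      obtain xs where xs: "z xs \<noteq> 0" using z(2) by blast
      then have "length xs = 3" using chains_support[OF zc(1)] by fastforce
      then obtain x y w where "xs = [x, y, w]" by (auto simp: numeral_3_eq_3 length_Suc_conv)
      then show ?thesis using xs unfolding Z_def by blast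
    qed
    show "\<exists>t. adjacent \<Delta> x t" if x: "x \<in> vertices \<Delta>" for x
    proof -
      have f: "{x} \<in> \<Delta>" using x singleton_face_iff[OF sc] by blast
      have "vertices (link \<Delta> {x}) \<noteq> {}"
        using homology_minus_1_vanishes_iff[where ?'f = 'f, OF simplicial_complex_link[OF sc f]] van[OF f, of "-1"] by simp
      then show ?thesis unfolding vertices_link[OF flag f] by blast
    qed
    show "cut_connected (adjacent \<Delta>) {t. adjacent \<Delta> x t}" if x: "x \<in> vertices \<Delta>" for x
    proof -
      have f: "{x} \<in> \<Delta>" using x singleton_face_iff[OF sc] by blast
      have vl: "vertices (link \<Delta> {x}) = {t. adjacent \<Delta> x t}"
        unfolding vertices_link[OF flag f] using adjacent_vertex_right[of \<Delta>] by blast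
      have "cut_connected (adjacent (link \<Delta> {x})) (vertices (link \<Delta> {x}))"
        by (rule homology_0_vanishes_connected[OF simplicial_complex_link[OF sc f]])
           (use van[OF f, of 0] in simp)
      then show ?thesis unfolding cut_connected_def vl adjacent_link[OF flag f] by blast
    qed
    show "\<exists>p q. p \<noteq> q \<and> \<not> adjacent \<Delta> p q \<and> (\<forall>t. (adjacent \<Delta> x t \<and> adjacent \<Delta> y t) = (t = p \<or> t = q))"
      if xy: "adjacent \<Delta> x y" for x y
    proof -
      have f: "{x, y} \<in> \<Delta>" "card {x, y} = 2" using xy unfolding adjacent_def by auto
      have vl: "vertices (link \<Delta> {x, y}) = {t. adjacent \<Delta> x t \<and> adjacent \<Delta> y t}"
        unfolding vertices_link[OF flag f(1)] using adjacent_vertex_right[of \<Delta>] by blast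
      \<comment> \<open>Faces of \<open>\<Delta>\<close> have at most three vertices, two of which
        are already \<open>x\<close> and \<open>y\<close>. This also keeps \<open>p\<close> and
        \<open>q\<close> from being adjacent.\<close>
      have small: "card \<tau> \<le> 1" if \<tau>: "\<tau> \<in> link \<Delta> {x, y}" for \<tau>
      proof -
        have "\<tau> \<in> \<Delta>" "\<tau> \<union> {x, y} \<in> \<Delta>" "\<tau> \<inter> {x, y} = {}" using \<tau> unfolding link_def by auto
        moreover from this have "finite \<tau>" using finite_face[OF sc] by blast
        ultimately show ?thesis using le3[of "\<tau> \<union> {x, y}"] card_Un_disjoint[of \<tau> "{x, y}"] f(2) by simp
      qed
      have "homology_is_field TYPE('f) (link \<Delta> {x, y}) 0" using fld[OF f(1)] f(2) by simp
      then obtain p q where pq: "p \<noteq> q" "vertices (link \<Delta> {x, y}) = {p, q}"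
        using two_vertices[OF simplicial_complex_link[OF sc f(1)] _ small] by blast
      have "\<not> adjacent \<Delta> p q"
      proof
        assume "adjacent \<Delta> p q"
        then have "{p, q} \<in> link \<Delta> {x, y}"
          using adjacent_link[OF flag f(1), of p q] pq(2) unfolding adjacent_def by blast
        then show False using small[of "{p, q}"] pq(1) by simp
      qed
      then show ?thesis using pq unfolding vl by (intro exI[of _ p] exI[of _ q]) blast
    qed
    fix k :: "'a \<Rightarrow> 'a \<Rightarrow> 'f" assume k: "chain1 (adjacent \<Delta>) k" "\<And>y. (\<Sum>t\<in>vertices \<Delta>. k t y) = 0"
    have "boundary_map \<Delta> (lift1 k) = (\<lambda>_. 0)" unfolding boundary_lift1 k(2) lift0_def by (auto split: list.split)
    then have "lift1 k \<in> cycles \<Delta> 1" using lift1_chain[OF k(1)] unfolding cycles_def by blast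
    moreover have "homology_vanishes TYPE('f) \<Delta> 1" using van[OF e, of 1] link_empty[OF e] by simp
    ultimately have "lift1 k \<in> boundaries \<Delta> 1" unfolding homology_vanishes_iff by blast
    then obtain d where d: "d \<in> chains \<Delta> 2" "lift1 k = boundary_map \<Delta> d" unfolding boundaries_def by auto
    have "(\<Sum>t\<in>vertices \<Delta>. d [t, x, y]) = k x y" for x y
      using fun_cong[OF d(2), of "[x, y]"] unfolding boundary_map_def by simp
    then show "\<exists>e. chain2 (adjacent \<Delta>) e \<and> (\<forall>x y. (\<Sum>t\<in>vertices \<Delta>. e t x y) = k x y)"
      using chain2_of_chains[OF d(1) sc] by (intro exI[of _ "\<lambda>x y w. d [x, y, w]"]) blast
  qed
  then show thesis by (rule that)
qed

lemma flag_induced: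
  assumes "flag K" "W \<subseteq> vertices K"
  shows "flag (induced K W)" "vertices (induced K W) = W"
    "adjacent (induced K W) x y \<longleftrightarrow> adjacent K x y \<and> x \<in> W \<and> y \<in> W"
proof -
  have sc: "simplicial_complex K" using assms unfolding flag_def by blast
  show V: "vertices (induced K W) = W"
    using assms(2) singleton_face_iff[OF sc] unfolding vertices_def induced_def by blast
  have adj: "adjacent (induced K W) x y \<longleftrightarrow> adjacent K x y \<and> x \<in> W \<and> y \<in> W" for x y
    unfolding adjacent_def induced_def by blast
  then show "adjacent (induced K W) x y \<longleftrightarrow> adjacent K x y \<and> x \<in> W \<and> y \<in> W" .
  have "simplicial_complex (induced K W)"
    using sc unfolding simplicial_complex_def induced_def by auto
  moreover have "induced K W = cliques (induced K W)"
  proof (intro equalityI subsetI)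
    fix \<sigma> assume "\<sigma> \<in> induced K W"
    then have "\<sigma> \<in> K" "\<sigma> \<subseteq> W" unfolding induced_def by blast+
    then show "\<sigma> \<in> cliques (induced K W)"
      using face_adjacent[OF sc, of \<sigma>] unfolding cliques_def V adj by blast
  next
    fix \<sigma> assume "\<sigma> \<in> cliques (induced K W)"
    then have "\<sigma> \<subseteq> W" "\<And>x y. x \<in> \<sigma> \<Longrightarrow> y \<in> \<sigma> \<Longrightarrow> x \<noteq> y \<Longrightarrow> adjacent K x y"
      unfolding cliques_def V adj by blast+
    then show "\<sigma> \<in> induced K W"
      using flag_clique[OF assms(1), of \<sigma>] assms(2) unfolding induced_def by blast
  qed
  ultimately show "flag (induced K W)" unfolding flag_def by blast
qed

text \<open>Triangle-freeness of \<open>C\<close> bounds the dimension, \<open>kappa\<close>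
  generates the top homology, and degree 2 turns the vertex links into pairs of points.\<close>

lemma separation_equator:
  fixes Z :: "'a \<Rightarrow> 'a \<Rightarrow> 'a \<Rightarrow> 'f::field"
  assumes flag: "flag \<Delta>" and dim: "dim_complex \<Delta> = 2"
    and sep: "separation (vertices \<Delta>) (adjacent \<Delta>) Z A B C"
  shows "equator TYPE('f) \<Delta> (induced \<Delta> C)"
proof -
  interpret separation "vertices \<Delta>" "adjacent \<Delta>" Z A B C by (rule sep)
  let ?E = "induced \<Delta> C"
  note E = flag_induced[OF flag sub(3)]
  have sc: "simplicial_complex ?E" using E(1) unfolding flag_def by blast
  have empty: "{} \<in> ?E" using sc unfolding simplicial_complex_def by blast
  have small: "card \<sigma> \<le> 2" if \<sigma>: "\<sigma> \<in> ?E" for \<sigma>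
  proof (rule ccontr)
    assume "\<not> card \<sigma> \<le> 2"
    then obtain S where S: "S \<subseteq> \<sigma>" "card S = 3" using obtain_subset_with_card_n[of 3 \<sigma>] by auto
    then obtain x y w where "S = {x, y, w}" "x \<noteq> y" "x \<noteq> w" "y \<noteq> w" by (auto simp: card_3_iff)
    moreover have "adjacent ?E s t" if "s \<in> S" "t \<in> S" "s \<noteq> t" for s t
      using face_adjacent[OF sc \<sigma>, of s t] S(1) that by blast
    ultimately show False unfolding E(3) using triangle_free[of x y w] by blast
  qed
  obtain c0 where c0: "c0 \<in> C" using C_nonempty by blast
  have "{x\<in>C. adjacent \<Delta> c0 x} \<noteq> {}" using degree_2[OF c0] by force
  then obtain x0 where x0: "x0 \<in> C" "adjacent \<Delta> c0 x0" by blast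
  have edge: "adjacent ?E c0 x0" using c0 x0 E(3) by blast
  have dimE: "dim_complex ?E = 1"
  proof -
    have "{c0, x0} \<in> ?E" "card {c0, x0} = 2" using edge unfolding adjacent_def by auto
    then have "Max (card ` ?E) = 2"
      by (intro Max_eqI) (use sc small in \<open>auto simp: simplicial_complex_def intro: rev_image_eqI\<close>)
    then show ?thesis unfolding dim_complex_def by simp
  qed
  have connE: "cut_connected (adjacent ?E) (vertices ?E)"
    using connected_C unfolding cut_connected_def E(2,3) by blast
  have H1: "homology_is_field TYPE('f) ?E 1"
  proof -
    have supp: "chain1 (adjacent ?E) kappa"
      using chain1_kappa unfolding chain1_def E(3) kappa_def by meson
    \<comment> \<open>Boundaries in \<open>?E\<close> sum over \<open>C\<close>, those of the graph
      over all vertices of \<open>\<Delta>\<close>; on chains supported in \<open>C\<close> they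
      agree.\<close>
    have sum_C: "(\<Sum>t\<in>C. f t y) = (\<Sum>t\<in>vertices \<Delta>. f t y)"
      if "\<And>x y. f x y \<noteq> 0 \<Longrightarrow> x \<in> C \<and> y \<in> C" for f :: "'a \<Rightarrow> 'a \<Rightarrow> 'f" and y
      by (rule sum.mono_neutral_left[OF finite_V sub(3)]) (use that in blast)
    have kappa_C: "x \<in> C \<and> y \<in> C" if "kappa x y \<noteq> 0" for x y
      using that unfolding kappa_def by meson
    have "(\<Sum>t\<in>C. kappa t y) = 0" for y using sum_C[of kappa y] kappa_C kappa_cycle by simp
    then have "boundary_map ?E (lift1 kappa) = (\<lambda>_. 0)"
      unfolding boundary_lift1 E(2) lift0_def by (auto split: list.split)
    then have z: "lift1 kappa \<in> cycles ?E 1" using lift1_chain[OF supp] unfolding cycles_def by blast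
    show ?thesis
    proof (rule homology_is_fieldI[OF z, of "[c0, x0]"])
      show "lift1 kappa [c0, x0] \<noteq> 0" using kappa_nonzero[OF c0 x0] by simp
      show "chains ?E (1 + 1) \<subseteq> {\<lambda>_. 0 :: 'f}" by (rule chains_trivial) (use small in fastforce)
      fix c :: "'a list \<Rightarrow> 'f" assume "c \<in> cycles ?E 1"
      then have c: "c \<in> chains ?E 1" "boundary_map ?E c = (\<lambda>_. 0)" unfolding cycles_def by blast+
      have c1: "chain1 (adjacent ?E) (\<lambda>x y. c [x, y])" by (rule chain1_of_chains[OF c(1)])
      have c_C: "x \<in> C \<and> y \<in> C" if "c [x, y] \<noteq> 0" for x y
        using c1 that unfolding chain1_def E(3) by blast
      have c2: "chain1 (adjacent \<Delta>) (\<lambda>x y. c [x, y])" using c1 unfolding chain1_def E(3) by blast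
      have c3: "(\<Sum>t\<in>vertices \<Delta>. c [t, y]) = 0" for y
        using fun_cong[OF c(2), of "[y]"] sum_C[of "\<lambda>x y. c [x, y]", OF c_C]
        unfolding boundary_map_def E(2) by simp
      obtain a where a: "\<And>x y. c [x, y] = a * kappa x y"
        using cycle_eq_multiple_of_kappa[OF c2 c_C c3] by blast
      have "c xs = a * lift1 kappa xs" for xs
        unfolding chains_1_eq_lift1[OF c(1), of xs] lift1_def a by (auto split: list.split)
      then show "\<exists>a. \<forall>xs. c xs = a * lift1 kappa xs" by blast
    qed
  qed
  have "homology_sphere TYPE('f) ?E"
    unfolding homology_sphere_def dimE
  proof (intro conjI ballI)
    show "simplicial_complex ?E" by (rule sc)
    fix \<sigma> assume \<sigma>: "\<sigma> \<in> ?E"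
    have L: "simplicial_complex (link ?E \<sigma>)" by (rule simplicial_complex_link[OF sc \<sigma>])
    have fin: "finite \<sigma>" using sc \<sigma> unfolding simplicial_complex_def by blast
    have link_small: "card \<tau> + card \<sigma> \<le> 2" if \<tau>: "\<tau> \<in> link ?E \<sigma>" for \<tau>
    proof -
      have "\<tau> \<in> ?E" "\<tau> \<union> \<sigma> \<in> ?E" "\<tau> \<inter> \<sigma> = {}" using \<tau> unfolding link_def by auto
      moreover from this have "finite \<tau>" using finite_face[OF sc] by blast
      ultimately show ?thesis using small[of "\<tau> \<union> \<sigma>"] card_Un_disjoint[of \<tau> \<sigma>] fin by simp
    qed
    consider "\<sigma> = {}" | c where "\<sigma> = {c}" | "card \<sigma> = 2"
      using small[OF \<sigma>] fin by (metis One_nat_def card_0_eq card_1_singletonE le_SucE le_zero_eq numeral_2_eq_2)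
    then have "(\<forall>i < 1 - int (card \<sigma>). homology_vanishes TYPE('f) (link ?E \<sigma>) i) \<and>
      homology_is_field TYPE('f) (link ?E \<sigma>) (1 - int (card \<sigma>))"
    proof cases
      case 1
      have "homology_vanishes TYPE('f) ?E i" if "i < 1" for i
      proof -
        consider "i = 0" | "i = -1" | "i < -1" using \<open>i < 1\<close> by linarith
        then show ?thesis
        proof cases
          case 1
          then show ?thesis using connected_homology_0_vanishes[OF sc connE] by simp
        next
          case 2
          then show ?thesis using homology_minus_1_vanishes_iff[OF sc] C_nonempty E(2) by simp
        qed (rule homology_vanishes_below)
      qed
      then show ?thesis using 1 link_empty[OF empty] H1 by simp
    next
      case (2 c)
      have cC: "c \<in> C" using \<sigma> 2 unfolding induced_def by blast
      have vl: "vertices (link ?E \<sigma>) = {x\<in>C. adjacent \<Delta> c x}"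
        unfolding vertices_link[OF E(1) \<sigma>] E(2,3) using 2 cC by blast
      obtain p q where pq: "vertices (link ?E \<sigma>) = {p, q}" "p \<noteq> q"
        using degree_2[OF cC] unfolding vl card_2_iff by blast
      have "homology_is_field TYPE('f) (link ?E \<sigma>) 0"
        by (rule homology_is_field_two_vertices[OF L _ pq(2,1)]) (use link_small 2 in fastforce)
      moreover have "homology_vanishes TYPE('f) (link ?E \<sigma>) i" if "i < 0" for i
      proof (cases "i = -1")
        case True
        then show ?thesis using homology_minus_1_vanishes_iff[OF L] pq by simp
      next
        case False
        then show ?thesis by (intro homology_vanishes_below) (use that in linarith)
      qed
      ultimately show ?thesis using 2 by simp
    next
      case 3
      have "\<tau> = {}" if "\<tau> \<in> link ?E \<sigma>" for \<tau>
        using link_small[OF that] 3 that L unfolding simplicial_complex_def by auto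
      moreover have "{} \<in> link ?E \<sigma>" using L unfolding simplicial_complex_def by blast
      ultimately have "link ?E \<sigma> = {{}}" by blast
      then show ?thesis using 3 by (simp add: homology_is_field_empty_face homology_vanishes_below)
    qed
    then show "\<forall>i < 1 - int (card \<sigma>). homology_vanishes TYPE('f) (link ?E \<sigma>) i"
      "homology_is_field TYPE('f) (link ?E \<sigma>) (1 - int (card \<sigma>))" by blast+
  qed
  then show ?thesis unfolding equator_def using E(1) dimE dim sub(3) by auto
qed

theorem theorem3p7:
  fixes \<Delta> :: "'a set set" and v :: 'a
  assumes "flag \<Delta>" and "homology_sphere TYPE('f::field) \<Delta>" and "dim_complex \<Delta> = 2"
    and "v \<in> vertices \<Delta>"
  shows "(\<exists>u\<in>vertices \<Delta>. card {w\<in>vertices \<Delta>. w \<noteq> u \<and> \<not> adjacent \<Delta> u w} \<le> 2) \<or>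
    (\<exists>E. equator TYPE('f) \<Delta> E \<and> (\<forall>u\<in>vertices \<Delta>. E \<noteq> link \<Delta> {u}) \<and> v \<notin> vertices E)"
proof (rule disj_imp[THEN iffD2, rule_format])
  assume "\<not> (\<exists>u\<in>vertices \<Delta>. card {w\<in>vertices \<Delta>. w \<noteq> u \<and> \<not> adjacent \<Delta> u w} \<le> 2)"
  then have many: "2 < card {w\<in>vertices \<Delta>. w \<noteq> u \<and> \<not> adjacent \<Delta> u w}" if "u \<in> vertices \<Delta>" for u
    using that by force
  obtain Z :: "'a \<Rightarrow> 'a \<Rightarrow> 'a \<Rightarrow> 'f" where "surface_graph (vertices \<Delta>) (adjacent \<Delta>) Z"
    using flag_sphere_surface_graph[OF assms(1-3)] by blast
  then interpret surface_graph "vertices \<Delta>" "adjacent \<Delta>" Z .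
  obtain A B C where sep: "separation (vertices \<Delta>) (adjacent \<Delta>) Z A B C" "v \<in> A"
    and big: "\<And>t. A \<noteq> {t}" "\<And>t. B \<noteq> {t}"
    using separating_cycle_or_few_non_neighbours[OF assms(4) many] by blast
  interpret separation "vertices \<Delta>" "adjacent \<Delta>" Z A B C by (rule sep)
  have VE: "vertices (induced \<Delta> C) = C" by (rule flag_induced(2)[OF assms(1) sub(3)])
  have "induced \<Delta> C \<noteq> link \<Delta> {u}" if u: "u \<in> vertices \<Delta>" for u
  proof
    assume eq: "induced \<Delta> C = link \<Delta> {u}"
    have "{u} \<in> \<Delta>" using u singleton_face_iff[of \<Delta>] assms(1) unfolding flag_def by blast
    then have "vertices (link \<Delta> {u}) = lk u"
      unfolding vertices_link[OF assms(1) \<open>{u} \<in> \<Delta>\<close>] lk_def using adjacent_vertex_right[of \<Delta> u] by auto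
    then have "C = lk u" using VE eq by simp
    then show False using C_eq_lk[OF u] big by blast
  qed
  moreover have "v \<notin> vertices (induced \<Delta> C)" using VE sep(2) disj by blast
  ultimately show "\<exists>E. equator TYPE('f) \<Delta> E \<and> (\<forall>u\<in>vertices \<Delta>. E \<noteq> link \<Delta> {u}) \<and> v \<notin> vertices E"
    using separation_equator[OF assms(1,3) sep(1)] by blast
qed

end
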